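(* If $t\in\mathbb{C}\setminus\{0\}$ and $|t|$ is sufficiently small (i.e. there exists $\varepsilon>0$ such that the following holds for all $t\in\mathbb{C}$ with $0<|t|<\varepsilon$), then \begin{align*} n_2\left(\frac{16}{t(1-t)}\right)&=9\,n_2\left(\frac{4(1+\sqrt{1-t})^6}{t^2\sqrt{1-t}}\right)+4\,n_2\left(\frac{-2^{10}(1+\sqrt{1-t})^6\sqrt{1-t}}{t^4}\right)\\ &\qquad -n_2\left(\frac{-16(1-t)^2}{t}\right)-8\,n_2\left(\frac{2(1+\sqrt[4]{1-t})^{12}}{t(1-\sqrt{1-t})^3\sqrt[4]{1-t}}\right). \end{align*}
   Context: For a nonzero Laurent polynomial $P\in\mathbb{C}[X_1^{\pm1},\ldots,X_n^{\pm1}]$, its (logarithmic) Mahler measure is \[ m(P)=\int_0^1\cdots\int_0^1\log|P(e^{2\pi i\theta_1},\ldots,e^{2\pi i\theta_n})|\,d\theta_1\cdots d\theta_n . \] For $s\in\mathbb{C}$, $n_2(s):=2m\left((x+x^{-1})(y+y^{-1})(z+z^{-1})+s^{1/2}\right)$ (the value does not depend on the choice of the square root $s^{1/2}$). The roots $\sqrt{1-t}$ and $\sqrt[4]{1-t}$ are the principal branches (equal to $1$ at $t=0$). *)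

theory Defs
  imports "HOL-Analysis.Analysis" "HOL-Library.Poly_Mapping"
begin

text \<open>
  The ring of Laurent polynomials in variables indexed by the finite type \<open>'n\<close> is the group
  algebra of the lattice \<open>int ^ 'n\<close>: a finitely supported map from exponent vectors to
  coefficients, with the convolution product provided by \<^theory>\<open>HOL-Library.Poly_Mapping\<close>.
\<close>
type_synonym 'n laurent_poly = "(int ^ 'n) \<Rightarrow>\<^sub>0 complex"

definition lvar :: "'n \<Rightarrow> 'n::finite laurent_poly" where
  "lvar i = Poly_Mapping.single (axis i 1) 1"

definition lvar_inv :: "'n \<Rightarrow> 'n::finite laurent_poly" where
  "lvar_inv i = Poly_Mapping.single (axis i (- 1)) 1"

definition lconst :: "complex \<Rightarrow> 'n::finite laurent_poly" where
  "lconst c = Poly_Mapping.single 0 c"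

definition leval :: "'n::finite laurent_poly \<Rightarrow> complex ^ 'n \<Rightarrow> complex" where
  "leval P z = (\<Sum>k\<in>Poly_Mapping.keys P. Poly_Mapping.lookup P k * (\<Prod>i\<in>UNIV. (z $ i) powi (k $ i)))"

text \<open>
  The iterated integral over \<open>[0,1]\<close> in each variable is taken as a single Lebesgue integral
  over the unit cube.  The notion is meant for nonzero \<open>P\<close>; then the points where \<open>P\<close> vanishes
  (at which \<^term>\<open>ln 0 = (0::real)\<close> is used) form a null set and the integrand is integrable.
\<close>
definition mahler_measure :: "'n::finite laurent_poly \<Rightarrow> real" where
  "mahler_measure P =
     (LINT \<theta>:cbox (0::real ^ 'n) 1|lborel. ln (cmod (leval P (\<chi> i. cis (2 * pi * \<theta> $ i)))))"

definition n2_poly :: "complex \<Rightarrow> 3 laurent_poly" where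
  "n2_poly r =
     (lvar 1 + lvar_inv 1) * (lvar 2 + lvar_inv 2) * (lvar 3 + lvar_inv 3) + lconst r"

text \<open>The measure does not depend on which square root is taken: replacing \<open>x\<close> by \<open>-x\<close> on the
  torus changes the sign of the product.\<close>
definition n2 :: "complex \<Rightarrow> real" where
  "n2 s = 2 * mahler_measure (n2_poly (csqrt s))"

end

theory Submission
  imports Defs "HOL-Complex_Analysis.Complex_Analysis"
begin

text \<open>
  For \<open>|s| > 64\<close>, expanding the logarithm and integrating termwise gives
  \<open>n2 s = ln |s| - Re (\<Sum>m\<ge>1. a\<^sub>m\<^sup>3 (64/s)\<^sup>m / m)\<close> with \<open>a\<^sub>m = (1/2)\<^sub>m / m!\<close>; hence the logarithmic derivative
  of this expression involves \<open>F(64/s)\<close>, where \<open>F = \<^sub>3F\<^sub>2(1/2,1/2,1/2;1,1)\<close>.  In the parameter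
  \<open>x = (1-r)/(1+r)\<close>, \<open>r = (1-t)\<^bsup>1/4\<^esup>\<close>, the five values \<open>z\<^sub>i = 64/s\<^sub>i\<close> are rational in \<open>x\<close>, and Clausen's
  formula \<open>F(4t(1-t)) = K(t)\<^sup>2\<close> together with Landen's transformation
  \<open>K(4y/(1+y)\<^sup>2) = (1+y) K(y\<^sup>2)\<close> for \<open>K = \<^sub>2F\<^sub>1(1/2,1/2;1)\<close> makes every \<open>F(z\<^sub>i)\<close> a polynomial multiple of
  \<open>F(z\<^sub>5)\<close>.  The derivative of the claimed relation then vanishes identically, and the constant is
  read off at \<open>x = 0\<close>.
\<close>

section \<open>Clausen's formula and Landen's transformation as formal power series\<close>

text \<open>This is the central binomial coefficient divided by 4^n, the 2n-th moment of the cosine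
  over a full period. The type is kept general so that the same sequence serves real integrals and
  complex series.\<close>

definition half_coeff :: "nat \<Rightarrow> 'a::field_char_0" where
  "half_coeff n = pochhammer (1/2) n / fact n"

lemma half_coeff_0 [simp]: "half_coeff 0 = 1"
  by (simp add: half_coeff_def)

lemma half_coeff_Suc:
  "(2 * of_nat n + 2) * half_coeff (Suc n) = (2 * of_nat n + 1) * (half_coeff n :: 'a::field_char_0)"
proof -
  have "of_nat n + 1 \<noteq> (0::'a)" using of_nat_neq_0[of n, where 'a='a] by (simp add: add.commute)
  moreover have "half_coeff (Suc n) = (half_coeff n * (1/2 + of_nat n) / (of_nat n + 1) :: 'a)"
    by (simp add: half_coeff_def pochhammer_Suc mult.commute add.commute)
  ultimately have "2 * ((of_nat n + 1) * half_coeff (Suc n)) = (2 * (half_coeff n * (1/2 + of_nat n)) :: 'a)" by simp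
  then show ?thesis by (simp add: algebra_simps)
qed

text \<open>For k = 2 this is \<open>K\<close>, that is 2/pi times the complete elliptic integral as
  a function of the squared modulus; for k = 3 it is \<open>F\<close>. One family covers both
  because the coefficient recurrence is simply raised to the k-th power.\<close>

definition half_fps :: "nat \<Rightarrow> 'a::field_char_0 fps" where
  "half_fps k = Abs_fps (\<lambda>n. half_coeff n ^ k)"

lemma half_fps_Suc:
  "(2 * of_nat n + 2)^k * fps_nth (half_fps k) (Suc n) = (2 * of_nat n + 1)^k * fps_nth (half_fps k :: 'a::field_char_0 fps) n"
  by (simp add: half_fps_def half_coeff_Suc flip: power_mult_distrib)

text \<open>The operators X^j D^j act diagonally on coefficients, by falling factorials. Once a
  differential equation is multiplied by a power of X, it becomes a recurrence that can be read off
  coefficientwise.\<close>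

lemma fps_nth_X_deriv: "fps_nth (fps_X * fps_deriv V) n = of_nat n * fps_nth V n"
  for V :: "'a::comm_ring_1 fps"
  by (cases n) (auto simp: fps_X_mult_nth)

lemma fps_nth_X2_deriv2: "fps_nth (fps_X^2 * fps_deriv (fps_deriv V)) n = of_nat n * (of_nat n - 1) * fps_nth V n"
  for V :: "'a::comm_ring_1 fps"
proof -
  have "fps_X^2 * fps_deriv (fps_deriv V) = fps_X * fps_deriv (fps_X * fps_deriv V) - fps_X * fps_deriv V"
    by (simp add: algebra_simps power2_eq_square)
  then show ?thesis by (simp only: fps_nth_X_deriv fps_sub_nth) (simp add: algebra_simps)
qed

lemma fps_nth_X3_deriv3: "fps_nth (fps_X^3 * fps_deriv (fps_deriv (fps_deriv V))) n
    = of_nat n * (of_nat n - 1) * (of_nat n - 2) * fps_nth V n"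
  for V :: "'a::comm_ring_1 fps"
proof -
  have "fps_X^3 * fps_deriv (fps_deriv (fps_deriv V))
      = fps_X * fps_deriv (fps_X^2 * fps_deriv (fps_deriv V)) - fps_const 2 * (fps_X^2 * fps_deriv (fps_deriv V))"
    by (simp add: fps_deriv_power algebra_simps power2_eq_square power3_eq_cube numeral_fps_const)
  then show ?thesis
    by (simp only: fps_nth_X_deriv fps_nth_X2_deriv2 fps_sub_nth fps_mult_left_const_nth) (simp add: algebra_simps)
qed

lemmas fps_nth_theta = fps_nth_X_deriv fps_nth_X2_deriv2 fps_nth_X3_deriv3

text \<open>With theta = X D, the recurrence for the coefficients says 4 theta^2 K = X (2 theta +
  1)^2 K. Rewriting theta^2 through X D and X^2 D^2 and cancelling one factor X gives the
  equation.\<close>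

lemma half_fps_2_ode:
  fixes K :: "'a::field_char_0 fps"
  defines "K \<equiv> half_fps 2"
  shows "4 * fps_X * (1 - fps_X) * fps_deriv (fps_deriv K) + 4 * (1 - 2 * fps_X) * fps_deriv K = K"
proof -
  let ?D1 = "fps_X * fps_deriv K" and ?D2 = "fps_X^2 * fps_deriv (fps_deriv K)"
  have "fps_const 4 * ?D2 + fps_const 4 * ?D1
      = fps_X * (K + fps_const 4 * ?D2 + fps_const 8 * ?D1)"
  proof (rule fps_ext)
    fix n
    show "fps_nth (fps_const 4 * ?D2 + fps_const 4 * ?D1) n
      = fps_nth (fps_X * (K + fps_const 4 * ?D2 + fps_const 8 * ?D1)) n"
    proof (cases n)
      case (Suc m)
      have "(2 * of_nat m + 2)^2 * fps_nth K (Suc m) = (2 * of_nat m + 1)^2 * fps_nth K m"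
        unfolding K_def by (rule half_fps_Suc)
      then show ?thesis
        unfolding Suc fps_add_nth fps_mult_left_const_nth fps_nth_theta
        unfolding fps_X_mult_nth fps_add_nth fps_mult_left_const_nth fps_nth_theta
        by (simp add: power2_eq_square algebra_simps)
    qed (simp_all add: fps_nth_theta)
  qed
  then have "fps_X * (4 * fps_X * (1 - fps_X) * fps_deriv (fps_deriv K) + 4 * (1 - 2 * fps_X) * fps_deriv K) = fps_X * K"
    unfolding fps_numeral_fps_const[symmetric] by algebra
  then show ?thesis by simp
qed

text \<open>The same argument, starting from 8 theta^3 F = X (2 theta + 1)^3 F.\<close>

lemma half_fps_3_ode:
  fixes F :: "'a::field_char_0 fps"
  defines "F \<equiv> half_fps 3"
  shows "8 * fps_X^2 * (1 - fps_X) * fps_deriv (fps_deriv (fps_deriv F))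
    + 12 * fps_X * (2 - 3 * fps_X) * fps_deriv (fps_deriv F) + 2 * (4 - 13 * fps_X) * fps_deriv F = F"
proof -
  let ?D1 = "fps_X * fps_deriv F" and ?D2 = "fps_X^2 * fps_deriv (fps_deriv F)"
    and ?D3 = "fps_X^3 * fps_deriv (fps_deriv (fps_deriv F))"
  have "fps_const 8 * ?D3 + fps_const 24 * ?D2 + fps_const 8 * ?D1
      = fps_X * (F + fps_const 8 * ?D3 + fps_const 36 * ?D2 + fps_const 26 * ?D1)"
  proof (rule fps_ext)
    fix n
    show "fps_nth (fps_const 8 * ?D3 + fps_const 24 * ?D2 + fps_const 8 * ?D1) n
      = fps_nth (fps_X * (F + fps_const 8 * ?D3 + fps_const 36 * ?D2 + fps_const 26 * ?D1)) n"
    proof (cases n)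
      case (Suc m)
      have "(2 * of_nat m + 2)^3 * fps_nth F (Suc m) = (2 * of_nat m + 1)^3 * fps_nth F m"
        unfolding F_def by (rule half_fps_Suc)
      then show ?thesis
        unfolding Suc fps_add_nth fps_mult_left_const_nth fps_nth_theta
        unfolding fps_X_mult_nth fps_add_nth fps_mult_left_const_nth fps_nth_theta
        by (simp add: power3_eq_cube algebra_simps)
    qed (simp_all add: fps_nth_theta)
  qed
  then have "fps_X * (8 * fps_X^2 * (1 - fps_X) * fps_deriv (fps_deriv (fps_deriv F))
    + 12 * fps_X * (2 - 3 * fps_X) * fps_deriv (fps_deriv F) + 2 * (4 - 13 * fps_X) * fps_deriv F) = fps_X * F"
    unfolding fps_numeral_fps_const[symmetric] by algebra
  then show ?thesis by simp
qed

text \<open>The equation is the symmetric square of the one in \<open>half_fps_2_ode\<close>.\<close>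

lemma clausen_ode_unique:
  fixes V :: "'a::field_char_0 fps"
  assumes ode: "2 * fps_X^2 * (1 - fps_X)^2 * fps_deriv (fps_deriv (fps_deriv V))
    + 6 * fps_X * (1 - fps_X) * (1 - 2 * fps_X) * fps_deriv (fps_deriv V)
    + 2 * (1 - 7 * fps_X + 7 * fps_X^2) * fps_deriv V - (1 - 2 * fps_X) * V = 0"
    and V0: "fps_nth V 0 = 0"
  shows "V = 0"
proof (rule fps_ext)
  fix n
  let ?D1 = "fps_X * fps_deriv V" and ?D2 = "fps_X^2 * fps_deriv (fps_deriv V)"
    and ?D3 = "fps_X^3 * fps_deriv (fps_deriv (fps_deriv V))"
  \<comment> \<open>Grouping by powers of X isolates 2 theta^3 on the left. The coefficient with
    index m + 1 is thus multiplied by 2 (m + 1)^3, nonzero in characteristic 0, and everything on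
    the right involves smaller indices only.\<close>
  have e: "fps_const 2 * ?D3 + fps_const 6 * ?D2 + fps_const 2 * ?D1
     = fps_X * (fps_const 4 * ?D3 + fps_const 18 * ?D2 + fps_const 14 * ?D1 + V)
       - fps_X^2 * (fps_const 2 * ?D3 + fps_const 12 * ?D2 + fps_const 14 * ?D1 + fps_const 2 * V)"
    using ode unfolding fps_numeral_fps_const[symmetric] by algebra
  show "fps_nth V n = fps_nth 0 n"
  proof (induction n rule: less_induct)
    case (less n)
    show ?case
    proof (cases n)
      case 0 then show ?thesis using V0 by simp
    next
      case (Suc m)
      have z: "fps_nth V k = 0" if "k \<le> m" for k using less that Suc by simp
      have n0: "of_nat m + 1 \<noteq> (0::'a)" using of_nat_neq_0[of m, where 'a='a] by (simp add: add.commute)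
      have "2 * (of_nat m + 1)^3 * fps_nth V (Suc m) = 0"
        using arg_cong[OF e, of "\<lambda>f. fps_nth f (Suc m)"]
        unfolding fps_add_nth fps_sub_nth fps_mult_left_const_nth fps_nth_theta
        unfolding fps_X_mult_nth fps_X_power_mult_nth fps_add_nth fps_sub_nth fps_mult_left_const_nth fps_nth_theta
        by (simp add: z power3_eq_cube algebra_simps split: if_splits)
      then show ?thesis using n0 Suc by simp
    qed
  qed
qed

text \<open>The point 0 is a regular singularity with double exponent 0: the left side of the
  recurrence is theta^2, so the constant term determines all later coefficients. A power series
  solution is therefore fixed by one initial value although the order is two.\<close>

lemma landen_ode_unique:
  fixes V :: "'a::field_char_0 fps"
  assumes ode: "fps_X * (1 - fps_X) * (1 + fps_X)^2 * fps_deriv (fps_deriv V)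
    + (1 - 2 * fps_X - fps_X^2) * (1 + fps_X) * fps_deriv V - (1 - fps_X) * V = 0"
    and V0: "fps_nth V 0 = 0"
  shows "V = 0"
proof (rule fps_ext)
  fix n
  let ?D1 = "fps_X * fps_deriv V" and ?D2 = "fps_X^2 * fps_deriv (fps_deriv V)"
  have e: "?D2 + ?D1 = fps_X * (V + ?D1 - ?D2) + fps_X^2 * (?D2 + fps_const 3 * ?D1 - V) + fps_X^3 * (?D2 + ?D1)"
    using ode unfolding fps_numeral_fps_const[symmetric] by algebra
  show "fps_nth V n = fps_nth 0 n"
  proof (induction n rule: less_induct)
    case (less n)
    show ?case
    proof (cases n)
      case 0 then show ?thesis using V0 by simp
    next
      case (Suc m)
      have z: "fps_nth V k = 0" if "k \<le> m" for k using less that Suc by simp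
      have n0: "of_nat m + 1 \<noteq> (0::'a)" using of_nat_neq_0[of m, where 'a='a] by (simp add: add.commute)
      have "(of_nat m + 1)^2 * fps_nth V (Suc m) = 0"
        using arg_cong[OF e, of "\<lambda>f. fps_nth f (Suc m)"]
        unfolding fps_add_nth fps_sub_nth fps_mult_left_const_nth fps_nth_theta
        unfolding fps_X_mult_nth fps_X_power_mult_nth fps_add_nth fps_sub_nth fps_mult_left_const_nth fps_nth_theta
        by (simp add: z power2_eq_square algebra_simps split: if_splits)
      then show ?thesis using n0 Suc by simp
    qed
  qed
qed

lemma fps_compose_numeral [simp]: "numeral k oo a = (numeral k :: 'a::comm_ring_1 fps)"
  by (metis fps_const_compose numeral_fps_const)

lemmas fps_compose_ring_distribs =
  fps_compose_add_distrib fps_compose_sub_distrib fps_compose_mult_distrib fps_compose_power[symmetric]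

text \<open>Both sides have constant term 1 and are annihilated by the third-order operator of
  \<open>clausen_ode_unique\<close>; their difference hence vanishes. The left side satisfies the
  equation of \<open>F\<close> pulled back along Z = 4X(1 - X), the right side the one derived from
  the equation of \<open>K\<close>.\<close>

theorem clausen:
  "half_fps 3 oo (4 * fps_X * (1 - fps_X)) = (half_fps 2 :: 'a::field_char_0 fps)^2"
proof -
  define F K Z :: "'a fps" where "F = half_fps 3" and "K = half_fps 2" and "Z = 4 * fps_X * (1 - fps_X)"
  define F1 F2 F3 where "F1 = fps_deriv F" and "F2 = fps_deriv F1" and "F3 = fps_deriv F2"
  define K1 K2 K3 where "K1 = fps_deriv K" and "K2 = fps_deriv K1" and "K3 = fps_deriv K2"
  have Z0: "fps_nth Z 0 = 0" by (simp add: Z_def mult.assoc)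
  have Z1: "fps_deriv Z = 4 - 8 * fps_X" by (simp add: Z_def algebra_simps)
  have Kode: "4 * fps_X * (1 - fps_X) * K2 + 4 * (1 - 2 * fps_X) * K1 = K"
    unfolding K2_def K1_def K_def by (rule half_fps_2_ode)
  have Kode': "4 * fps_X * (1 - fps_X) * K3 + 8 * (1 - 2 * fps_X) * K2 - 9 * K1 = 0"
    using arg_cong[OF Kode, of fps_deriv] unfolding K3_def[symmetric] K2_def[symmetric] K1_def[symmetric]
    by (simp add: K3_def[symmetric] K2_def[symmetric] K1_def[symmetric] algebra_simps)
  have "(8 * fps_X^2 * (1 - fps_X) * F3 + 12 * fps_X * (2 - 3 * fps_X) * F2 + 2 * (4 - 13 * fps_X) * F1) oo Z = F oo Z"
    unfolding F3_def F2_def F1_def F_def by (simp only: half_fps_3_ode)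
  then have Fode: "8 * Z^2 * (1 - Z) * (F3 oo Z) + 12 * Z * (2 - 3 * Z) * (F2 oo Z) + 2 * (4 - 13 * Z) * (F1 oo Z) = F oo Z"
    by (simp add: fps_compose_ring_distribs Z0)
  define L where "L = F oo Z"
  have L1: "fps_deriv L = (F1 oo Z) * (4 - 8 * fps_X)"
    unfolding L_def F1_def by (simp add: fps_compose_deriv Z0 Z1)
  have L2: "fps_deriv (fps_deriv L) = (F2 oo Z) * (4 - 8 * fps_X)^2 - 8 * (F1 oo Z)"
    unfolding L1 F2_def by (simp add: fps_compose_deriv Z0 Z1 algebra_simps power2_eq_square)
  have L3: "fps_deriv (fps_deriv (fps_deriv L)) = (F3 oo Z) * (4 - 8 * fps_X)^3 - 24 * (F2 oo Z) * (4 - 8 * fps_X)"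
    unfolding L2 F3_def
    by (simp add: fps_deriv_power F2_def[symmetric] fps_compose_deriv Z0 Z1 algebra_simps power2_eq_square power3_eq_cube)
  define W where "W = K^2"
  have W1: "fps_deriv W = 2 * K * K1"
    unfolding W_def K1_def by (simp add: power2_eq_square algebra_simps)
  have W2: "fps_deriv (fps_deriv W) = 2 * K * K2 + 2 * K1^2"
    unfolding W1 K2_def by (simp add: K1_def[symmetric] power2_eq_square algebra_simps)
  have W3: "fps_deriv (fps_deriv (fps_deriv W)) = 2 * K * K3 + 6 * K1 * K2"
    unfolding W2 K3_def by (simp add: K1_def[symmetric] K2_def[symmetric] power2_eq_square algebra_simps)
  let ?O = "\<lambda>V. 2 * fps_X^2 * (1 - fps_X)^2 * fps_deriv (fps_deriv (fps_deriv V))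
    + 6 * fps_X * (1 - fps_X) * (1 - 2 * fps_X) * fps_deriv (fps_deriv V)
    + 2 * (1 - 7 * fps_X + 7 * fps_X^2) * fps_deriv V - (1 - 2 * fps_X) * V"
  \<comment> \<open>Since Z' = 4(1 - 2X) and 1 - Z = (1 - 2X)^2, the operator applied to L is the
    equation of \<open>F\<close> at Z multiplied by 1 - 2X.\<close>
  have "?O L = (1 - 2 * fps_X) * (8 * Z^2 * (1 - Z) * (F3 oo Z) + 12 * Z * (2 - 3 * Z) * (F2 oo Z)
      + 2 * (4 - 13 * Z) * (F1 oo Z) - (F oo Z))"
    unfolding L3 unfolding L2 unfolding L1 unfolding L_def Z_def by algebra
  then have OL: "?O L = 0" using Fode by simp
  \<comment> \<open>The third derivative of K^2 involves K''', so the certificate combines the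
    equation of \<open>K\<close> with its derivative \<open>Kode'\<close>.\<close>
  have "?O W = fps_X * (1 - fps_X) * K * (4 * fps_X * (1 - fps_X) * K3 + 8 * (1 - 2 * fps_X) * K2 - 9 * K1)
      + (3 * fps_X * (1 - fps_X) * K1 + (1 - 2 * fps_X) * K)
        * (4 * fps_X * (1 - fps_X) * K2 + 4 * (1 - 2 * fps_X) * K1 - K)"
    unfolding W3 unfolding W2 unfolding W1 unfolding W_def by algebra
  then have OW: "?O W = 0" using Kode Kode' by simp
  have "L - W = 0"
  proof (rule clausen_ode_unique)
    show "?O (L - W) = 0" using OL OW unfolding fps_deriv_sub by algebra
    show "fps_nth (L - W) 0 = 0"
      by (simp add: L_def W_def F_def K_def half_fps_def power2_eq_square)
  qed
  then show ?thesis by (simp add: L_def W_def F_def K_def Z_def)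
qed


text \<open>The same method in order two: the equation of \<open>K\<close> is pulled back along T =
  4X/(1 + X)^2 and along X^2, and after multiplication by 1 - X and X(1 + X)^2 respectively both
  become the equation of \<open>landen_ode_unique\<close>. Both sides start with 1.\<close>

theorem landen:
  "half_fps 2 oo (4 * fps_X * inverse (1 + fps_X)^2) = (1 + fps_X) * (half_fps 2 oo (fps_X^2) :: 'a::field_char_0 fps)"
proof -
  define K I T :: "'a fps" where "K = half_fps 2" and "I = inverse (1 + fps_X)" and "T = 4 * fps_X * I^2"
  define K1 K2 where "K1 = fps_deriv K" and "K2 = fps_deriv K1"
  have Kode: "4 * fps_X * (1 - fps_X) * K2 + 4 * (1 - 2 * fps_X) * K1 = K"
    unfolding K2_def K1_def K_def by (rule half_fps_2_ode)
  \<comment> \<open>The inverse is treated as an indeterminate subject to this one relation, which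
    reduces the later verification to polynomial ideal membership.\<close>
  have I: "(1 + fps_X) * I = 1"
    unfolding I_def by (rule inverse_mult_eq_1') simp
  have I1: "fps_deriv I = - (I^2)" unfolding I_def by (subst fps_inverse_deriv) auto
  have T0: "fps_nth T 0 = 0" by (simp add: T_def mult.assoc)
  have T1: "fps_deriv T = 4 * I^2 - 8 * fps_X * I^3"
    unfolding T_def by (simp add: I1 fps_deriv_power algebra_simps power2_eq_square power3_eq_cube)
  have Q0: "fps_nth (fps_X^2 :: 'a fps) 0 = 0" by simp
  have Q1: "fps_deriv (fps_X^2) = (2 * fps_X :: 'a fps)" by (simp add: power2_eq_square algebra_simps)
  have Tode: "4 * T * (1 - T) * (K2 oo T) + 4 * (1 - 2 * T) * (K1 oo T) = K oo T"
    using arg_cong[OF Kode, of "\<lambda>f. f oo T"] by (simp add: fps_compose_ring_distribs T0)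
  have Qode: "4 * fps_X^2 * (1 - fps_X^2) * (K2 oo fps_X^2) + 4 * (1 - 2 * fps_X^2) * (K1 oo fps_X^2) = K oo fps_X^2"
    using arg_cong[OF Kode, of "\<lambda>f. f oo fps_X^2"] by (simp add: fps_compose_ring_distribs)
  define S where "S = K oo T"
  have S1: "fps_deriv S = (K1 oo T) * fps_deriv T"
    unfolding S_def K1_def by (simp add: fps_compose_deriv T0)
  have S2: "fps_deriv (fps_deriv S) = (K2 oo T) * (fps_deriv T)^2 + (K1 oo T) * (24 * fps_X * I^4 - 16 * I^3)"
    unfolding S1 K2_def
    by (simp add: fps_compose_deriv T0 T1 I1 fps_deriv_power algebra_simps eval_nat_numeral)
  define R where "R = (1 + fps_X) * (K oo fps_X^2)"
  have R1: "fps_deriv R = (K oo fps_X^2) + 2 * fps_X * (1 + fps_X) * (K1 oo fps_X^2)"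
    unfolding R_def K1_def by (simp add: fps_compose_deriv Q0 Q1 algebra_simps)
  have R2: "fps_deriv (fps_deriv R) = (2 + 6 * fps_X) * (K1 oo fps_X^2) + 4 * fps_X^2 * (1 + fps_X) * (K2 oo fps_X^2)"
    unfolding R1 K2_def by (simp add: K1_def[symmetric] fps_compose_deriv Q0 Q1 algebra_simps power2_eq_square)
  let ?O = "\<lambda>V. fps_X * (1 - fps_X) * (1 + fps_X)^2 * fps_deriv (fps_deriv V)
    + (1 - 2 * fps_X - fps_X^2) * (1 + fps_X) * fps_deriv V - (1 - fps_X) * V"
  have "?O S = (1 - fps_X) * (4 * T * (1 - T) * (K2 oo T) + 4 * (1 - 2 * T) * (K1 oo T) - (K oo T))"
    unfolding S2 unfolding S1 unfolding T1 unfolding S_def T_def using I by algebra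
  then have OS: "?O S = 0" using Tode by simp
  have "?O R = fps_X * (1 + fps_X)^2 * (4 * fps_X^2 * (1 - fps_X^2) * (K2 oo fps_X^2)
      + 4 * (1 - 2 * fps_X^2) * (K1 oo fps_X^2) - (K oo fps_X^2))"
    unfolding R2 unfolding R1 unfolding R_def by algebra
  then have OR: "?O R = 0" using Qode by simp
  have "S - R = 0"
  proof (rule landen_ode_unique)
    show "?O (S - R) = 0" using OS OR unfolding fps_deriv_sub by algebra
    show "fps_nth (S - R) 0 = 0"
      by (simp add: S_def R_def K_def half_fps_def)
  qed
  then show ?thesis by (simp add: S_def R_def K_def T_def I_def)
qed

section \<open>The Mahler measure as a power series\<close>

lemma leval_add: "leval (P + Q) z = leval P z + leval Q z"
  unfolding leval_def by (rule setsum_keys_plus_distrib) (auto simp: algebra_simps)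

lemma leval_0: "leval 0 z = 0"
  by (simp add: leval_def)

lemma leval_single: "leval (Poly_Mapping.single k c) z = c * (\<Prod>i\<in>UNIV. (z $ i) powi (k $ i))"
  by (simp add: leval_def)

lemma poly_mapping_add_induct [case_names zero single add]:
  assumes "P 0" "\<And>k c. P (Poly_Mapping.single k c)" "\<And>f g. P f \<Longrightarrow> P g \<Longrightarrow> P (f + g)"
  shows "P (f :: 'a \<Rightarrow>\<^sub>0 'b::monoid_add)"
proof (induction f rule: update_induct)
  case const
  show ?case by (rule assms)
next
  case (update f k c)
  have "Poly_Mapping.update k c f = f + Poly_Mapping.single k c"
    using update.hyps(1)
    by (intro poly_mapping_eqI) (auto simp: lookup_update lookup_add lookup_single when_def in_keys_iff)
  with assms update.IH show ?case by simp
qed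

text \<open>By bilinearity it suffices to treat two monomials, where the claim is additivity of
  integer powers in the exponent. Exponents may be negative, whence the nonvanishing
  coordinates.\<close>

lemma leval_mult:
  fixes z :: "complex ^ 'n::finite"
  assumes "\<And>i. z $ i \<noteq> 0"
  shows "leval (P * Q) z = leval P z * leval Q z"
proof (induction P rule: poly_mapping_add_induct)
  case (single k c)
  show ?case
  proof (induction Q rule: poly_mapping_add_induct)
    case (single l d)
    show ?case
      by (simp add: mult_single leval_single power_int_add assms prod.distrib)
  qed (simp_all add: leval_add distrib_left leval_0)
qed (simp_all add: leval_add distrib_right leval_0)

lemma leval_lvar: "leval (lvar i) z = z $ i"
proof -
  have "(\<Prod>j\<in>UNIV. (z $ j) powi (axis i 1 $ j)) = (\<Prod>j\<in>UNIV. if j = i then z $ j else 1)"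
    by (intro prod.cong) (auto simp: axis_def)
  then show ?thesis by (simp add: lvar_def leval_single)
qed

lemma leval_lvar_inv: "leval (lvar_inv i) z = inverse (z $ i)"
proof -
  have "(\<Prod>j\<in>UNIV. (z $ j) powi (axis i (-1) $ j)) = (\<Prod>j\<in>UNIV. if j = i then inverse (z $ j) else 1)"
    by (intro prod.cong) (auto simp: axis_def power_int_minus)
  then show ?thesis by (simp add: lvar_inv_def leval_single)
qed

lemma leval_lconst: "leval (lconst c) z = c"
  by (simp add: lconst_def leval_single)

lemma leval_n2_poly:
  "leval (n2_poly r) (\<chi> i. cis (2 * pi * \<theta> $ i)) = r + of_real (8 * (\<Prod>i\<in>UNIV. cos (2 * pi * \<theta> $ i)))"
proof -
  have "cis x + inverse (cis x) = of_real (2 * cos x)" for x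
    unfolding cis_inverse by (rule complex_eqI) auto
  note cis = this
  define z :: "complex^3" where "z = (\<chi> i. cis (2 * pi * \<theta> $ i))"
  have z: "z $ i = cis (2 * pi * \<theta> $ i)" for i by (simp add: z_def)
  have nz: "z $ i \<noteq> 0" for i by (simp add: z)
  have "leval (n2_poly r) z = of_real (2 * cos (2 * pi * \<theta> $ 1)) *
      of_real (2 * cos (2 * pi * \<theta> $ 2)) * of_real (2 * cos (2 * pi * \<theta> $ 3)) + r"
    unfolding n2_poly_def leval_add leval_mult[OF nz] leval_lvar leval_lvar_inv leval_lconst z cis ..
  also have "\<dots> = r + of_real (8 * (\<Prod>i\<in>UNIV. cos (2 * pi * \<theta> $ i)))"
    by (simp only: UNIV_3 of_real_mult[symmetric]) simp
  finally show ?thesis by (simp add: z_def)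
qed

section \<open>Moments of the cosine and integration over the cube\<close>

text \<open>Integrating the derivative of cos^(n+1) sin over a full period gives 0, and sin^2 = 1 -
  cos^2 turns this into the recursion.\<close>

lemma cos_power_integral_rec:
  "((\<lambda>u. cos (2 * pi * u) ^ n) has_integral I) {0..1::real} \<Longrightarrow>
    ((\<lambda>u. cos (2 * pi * u) ^ (n + 2)) has_integral ((n + 1) / (n + 2) * I)) {0..1}"
proof -
  assume I: "((\<lambda>u. cos (2 * pi * u) ^ n) has_integral I) {0..1::real}"
  let ?G = "\<lambda>u::real. inverse (2 * pi) * (cos (2 * pi * u) ^ (n + 1) * sin (2 * pi * u))"
  let ?g = "\<lambda>u::real. (n + 2) * cos (2 * pi * u) ^ (n + 2) - (n + 1) * cos (2 * pi * u) ^ n"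
  have "(?g has_integral (?G 1 - ?G 0)) {0..1}"
  proof (rule fundamental_theorem_of_calculus)
    fix u :: real
    have "(?G has_real_derivative inverse (2 * pi) * (real (n + 1) * cos (2 * pi * u) ^ n * (- sin (2 * pi * u) * (2 * pi)) * sin (2 * pi * u)
        + cos (2 * pi * u) * (2 * pi) * cos (2 * pi * u) ^ (n + 1))) (at u)"
      by (rule DERIV_cmult DERIV_mult derivative_eq_intros refl | simp)+
    also have "inverse (2 * pi) * (real (n + 1) * cos (2 * pi * u) ^ n * (- sin (2 * pi * u) * (2 * pi)) * sin (2 * pi * u)
        + cos (2 * pi * u) * (2 * pi) * cos (2 * pi * u) ^ (n + 1))
        = (n + 1) * cos (2 * pi * u) ^ n * (- ((sin (2 * pi * u))^2)) + cos (2 * pi * u) ^ (n + 2)"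
      by (simp add: field_simps power2_eq_square)
    also have "\<dots> = ?g u"
      unfolding sin_squared_eq by (simp add: algebra_simps power_add power2_eq_square)
    finally show "(?G has_vector_derivative ?g u) (at u within {0..1})"
      by (simp add: has_real_derivative_iff_has_vector_derivative has_vector_derivative_at_within)
  qed simp
  then have "(?g has_integral 0) {0..1}" by simp
  from has_integral_add[OF this has_integral_mult_right[OF I, of "n + 1"]]
  have "((\<lambda>u. (n + 2) * cos (2 * pi * u) ^ (n + 2)) has_integral ((n + 1) * I)) {0..1}"
    by (simp add: algebra_simps)
  from has_integral_mult_right[OF this, of "1 / (n + 2)"]
  have "((\<lambda>u. 1 / (n + 2) * ((n + 2) * cos (2 * pi * u) ^ (n + 2))) has_integral ((n + 1) / (n + 2) * I)) {0..1}"
    by simp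
  moreover have "1 / real (n + 2) * (real (n + 2) * x) = x" for x by simp
  ultimately show ?thesis by (simp only: of_nat_add of_nat_1 of_nat_numeral)
qed

lemma cos_power_integral_even:
  "((\<lambda>u. cos (2 * pi * u) ^ (2 * m)) has_integral half_coeff m) {0..1::real}"
proof (induction m)
  case 0
  then show ?case using has_integral_const_real[of "1::real" 0 1] by simp
next
  case (Suc m)
  have "(real (2 * m) + 1) / (real (2 * m) + 2) * half_coeff m = half_coeff (Suc m)"
    using half_coeff_Suc[of m, where 'a=real] by (simp add: field_simps)
  then show ?case using cos_power_integral_rec[OF Suc] by (simp add: add.commute)
qed

lemma cos_power_integral_odd:
  "((\<lambda>u. cos (2 * pi * u) ^ (2 * m + 1)) has_integral 0) {0..1::real}"
proof (induction m)
  case 0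
  have "((\<lambda>u. cos (2 * pi * u)) has_integral (sin (2 * pi * 1) / (2 * pi) - sin (2 * pi * 0) / (2 * pi))) {0..1::real}"
    by (rule fundamental_theorem_of_calculus)
      (auto intro!: derivative_eq_intros simp: has_real_derivative_iff_has_vector_derivative[symmetric])
  then show ?case by simp
next
  case (Suc m)
  then show ?case using cos_power_integral_rec[OF Suc] by (simp add: add.commute)
qed

lemma prod_Basis_vec: "(\<Prod>b\<in>Basis. h (x \<bullet> b)) = (\<Prod>i\<in>UNIV. h (x $ i))"
  for x :: "real ^ 'n" and h :: "real \<Rightarrow> 'a::comm_monoid_mult"
proof -
  have B: "(Basis :: (real^'n) set) = (\<lambda>i. axis i 1) ` UNIV" by (auto simp: Basis_vec_def)
  have "inj (\<lambda>i. axis i (1::real) :: real^'n)" by (auto intro!: injI simp: axis_eq_axis)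
  then show ?thesis unfolding B by (subst prod.reindex) (auto simp: inner_axis o_def)
qed

text \<open>Lebesgue measure on the space is the image of the product measure indexed by the basis,
  and the indicator of the cube also factors over coordinates, so Fubini applies.\<close>

lemma set_integral_unit_cube_prod:
  fixes f :: "real \<Rightarrow> real"
  assumes "continuous_on {0..1} f"
  shows "(LINT x:cbox 0 (1::real^'n::finite)|lborel. \<Prod>i\<in>UNIV. f (x $ i)) = (LINT u:{0..1}|lborel. f u) ^ CARD('n)"
proof -
  let ?h = "\<lambda>u. indicator {0..1} u * f u"
  have i: "integrable lborel ?h"
    using borel_integrable_atLeastAtMost'[OF assms] by (simp add: set_integrable_def)
  then have [measurable]: "?h \<in> borel_measurable borel" using borel_measurable_integrable by force
  have cb: "indicator (cbox 0 1) x = (\<Prod>i\<in>UNIV. indicator {0..1} (x $ i) :: real)" for x :: "real^'n"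
    by (auto simp: indicator_def mem_box_cart)
  have "(LINT x:cbox 0 (1::real^'n)|lborel. \<Prod>i\<in>UNIV. f (x $ i)) = integral\<^sup>L lborel (\<lambda>x::real^'n. \<Prod>b\<in>Basis. ?h (x \<bullet> b))"
    unfolding set_lebesgue_integral_def
    by (simp add: cb prod.distrib prod_Basis_vec[of "indicator {0..1}"] prod_Basis_vec[of f])
  also have "\<dots> = integral\<^sup>L (Pi\<^sub>M (Basis::(real^'n) set) (\<lambda>_. lborel)) (\<lambda>y. \<Prod>b\<in>Basis. ?h ((\<Sum>b\<in>Basis. y b *\<^sub>R b) \<bullet> b))"
    by (subst lborel_eq, subst integral_distr) auto
  also have "\<dots> = integral\<^sup>L (Pi\<^sub>M (Basis::(real^'n) set) (\<lambda>_. lborel)) (\<lambda>y. \<Prod>b\<in>Basis. ?h (y b))"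
    by (simp cong: prod.cong)
  also have "\<dots> = (\<Prod>b\<in>(Basis::(real^'n) set). integral\<^sup>L lborel ?h)"
  proof -
    interpret product_sigma_finite "\<lambda>_::real^'n. lborel :: real measure" ..
    show ?thesis by (rule product_integral_prod) (auto simp: i)
  qed
  also have "\<dots> = (LINT u:{0..1}|lborel. f u) ^ CARD('n)"
    by (simp add: set_lebesgue_integral_def)
  finally show ?thesis .
qed


lemma cos_power_set_integral:
  "(LINT u:{0..1}|lborel. cos (2 * pi * u) ^ n) = (if even n then half_coeff (n div 2) else 0)"
proof -
  have "set_integrable lborel {0..1} (\<lambda>u::real. cos (2 * pi * u) ^ n)"
    by (intro borel_integrable_atLeastAtMost' continuous_intros)
  then have "(LINT u:{0..1}|lborel. cos (2 * pi * u) ^ n) = integral {0..1} (\<lambda>u. cos (2 * pi * u) ^ n)"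
    by (rule set_borel_integral_eq_integral)
  also have "\<dots> = (if even n then half_coeff (n div 2) else 0)"
    using cos_power_integral_even[of "n div 2"] cos_power_integral_odd[of "n div 2"]
    by (cases "even n") (auto intro!: integral_unique simp flip: odd_two_times_div_two_succ elim!: oddE)
  finally show ?thesis .
qed

section \<open>Radii of convergence and the logarithmic expansion\<close>

lemma abs_half_coeff_le: "\<bar>half_coeff n :: real\<bar> \<le> 1"
proof -
  have "0 \<le> (half_coeff n :: real) \<and> half_coeff n \<le> (1::real)"
  proof (induction n)
    case (Suc n)
    have "half_coeff (Suc n) = (2 * real n + 1) / (2 * real n + 2) * half_coeff n"
      using half_coeff_Suc[of n, where 'a=real] by (simp add: field_simps)
    moreover have "(2 * real n + 1) / (2 * real n + 2) * half_coeff n \<le> 1 * 1"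
      using Suc by (intro mult_mono) auto
    ultimately show ?case using Suc by simp
  qed simp
  then show ?thesis by simp
qed

lemma of_real_half_coeff [simp]: "of_real (half_coeff n) = (half_coeff n :: 'a::{real_field})"
  using pochhammer_of_real[of "1/2" n, where 'a='a] by (simp add: half_coeff_def)

lemma norm_half_coeff_le: "norm (half_coeff n :: complex) \<le> 1"
  by (metis abs_half_coeff_le norm_of_real of_real_half_coeff)

lemma fps_conv_radius_bounded:
  fixes f :: "complex fps"
  assumes "\<And>n. norm (fps_nth f n) \<le> 1"
  shows "fps_conv_radius f \<ge> 1"
proof -
  have "summable (\<lambda>n. fps_nth f n * of_real r ^ n)" if r: "0 < r" "r < 1" for r :: real
  proof (rule summable_comparison_test')
    show "summable (\<lambda>n. r ^ n)" using r by (simp add: summable_geometric)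
    show "norm (fps_nth f n * of_real r ^ n) \<le> r ^ n" for n
      using assms[of n] r by (simp add: norm_mult norm_power mult_left_le_one_le)
  qed
  then show ?thesis unfolding fps_conv_radius_def by (intro conv_radius_geI_ex') auto
qed

text \<open>The formal integral of (F - 1)/X. Division by zero yields 0, so the constant coefficient
  vanishes without a case distinction.\<close>

definition n2_log_fps :: "complex fps" where
  "n2_log_fps = Abs_fps (\<lambda>n. half_coeff n ^ 3 / of_nat n)"

lemma fps_conv_radius_half_fps: "fps_conv_radius (half_fps k :: complex fps) \<ge> 1"
  by (rule fps_conv_radius_bounded) (simp add: half_fps_def norm_power norm_half_coeff_le power_le_one)

lemma fps_conv_radius_n2_log_fps: "fps_conv_radius n2_log_fps \<ge> 1"
proof (rule fps_conv_radius_bounded)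
  fix n
  have "norm (half_coeff n ^ 3 :: complex) / real n \<le> 1 / 1"
    by (cases "n = 0") (simp, intro frac_le, auto simp: norm_power norm_half_coeff_le power_le_one)
  then show "norm (fps_nth n2_log_fps n) \<le> 1" by (simp add: n2_log_fps_def norm_divide)
qed

text \<open>A square root r of s has modulus above 8, while the product p of the three cosines is at
  most 1 in modulus. Hence ln |r + 8p| expands in powers of p with coefficients dominated by a
  geometric series, and sum and integral may be exchanged. The integral of p^n is the cube of a
  one-dimensional moment.\<close>

theorem n2_eq_eval_fps:
  assumes s: "norm s > 64"
  shows "n2 s = ln (norm s) - Re (eval_fps n2_log_fps (64 / s))"
proof -
  define r where "r = csqrt s"
  define w where "w = 8 / r"
  define p :: "real^3 \<Rightarrow> real" where "p = (\<lambda>\<theta>. \<Prod>i\<in>UNIV. cos (2 * pi * \<theta> $ i))"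
  \<comment> \<open>The logarithm series has term 0 at n = 0, so that slot is free to hold the
    constant ln |r|.\<close>
  define a where "a n = (if n = 0 then ln (norm r) else Re ((-1) ^ Suc n / of_nat n * w ^ n))" for n
  define f where "f n \<theta> = indicator (cbox 0 1) \<theta> * (a n * p \<theta> ^ n)" for n and \<theta> :: "real^3"
  have Re_real: "Re (of_real x * z) = x * Re z" for x z by simp
  have r2: "r ^ 2 = s" by (simp add: r_def)
  then have "norm r ^ 2 > 8 ^ 2" using s by (simp flip: norm_power)
  then have r: "norm r > 8" by (rule power_less_imp_less_base) simp
  then have r0: "r \<noteq> 0" by auto
  have w: "norm w < 1" using r by (simp add: w_def norm_divide divide_less_eq)
  have p_le: "\<bar>p \<theta>\<bar> \<le> 1" for \<theta>
    unfolding p_def abs_prod by (rule prod_le_1) auto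
  have a_sums: "(\<lambda>n. a n * p \<theta> ^ n) sums ln (norm (r + of_real (8 * p \<theta>)))" for \<theta>
  proof -
    let ?g = "w * of_real (p \<theta>)"
    have "norm ?g \<le> norm w * 1" unfolding norm_mult using p_le[of \<theta>] by (intro mult_left_mono) auto
    then have g: "norm ?g < 1" using w by simp
    then have g1: "1 + ?g \<noteq> 0" by (metis add_eq_0_iff norm_minus_cancel norm_one less_irrefl)
    have "r + of_real (8 * p \<theta>) = r * (1 + ?g)" using r by (auto simp: w_def field_simps)
    then have "ln (norm (r + of_real (8 * p \<theta>))) = ln (norm r) + Re (Ln (1 + ?g))"
      using g1 r0 by (simp add: norm_mult ln_mult)
    moreover have "(\<lambda>n. Re ((-1) ^ Suc n / of_nat n * ?g ^ n)) sums Re (Ln (1 + ?g))"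
      by (rule sums_Re) (rule Ln_series[OF g])
    moreover have "(\<lambda>n. if n = 0 then ln (norm r) else 0) sums ln (norm r)"
      using sums_single[of 0 "\<lambda>_. ln (norm r)"] by simp
    ultimately have "(\<lambda>n. (if n = 0 then ln (norm r) else 0) + Re ((-1) ^ Suc n / of_nat n * ?g ^ n))
        sums ln (norm (r + of_real (8 * p \<theta>)))"
      using sums_add by force
    moreover have "(if n = 0 then ln (norm r) else 0) + Re ((-1) ^ Suc n / of_nat n * ?g ^ n) = a n * p \<theta> ^ n" for n
    proof -
      have "(-1) ^ Suc n / of_nat n * ?g ^ n = of_real (p \<theta> ^ n) * ((-1) ^ Suc n / of_nat n * w ^ n)"
        by (simp add: power_mult_distrib)
      then show ?thesis by (simp only: a_def Re_real) (cases "n = 0"; simp)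
    qed
    ultimately show ?thesis by simp
  qed
  have a_summable: "summable (\<lambda>n. \<bar>a n\<bar>)"
  proof (rule summable_comparison_test')
    show "summable (\<lambda>n. norm w ^ n)" using w by simp
    fix n :: nat assume "n \<ge> 1"
    have "\<bar>Re ((-1) ^ Suc n / of_nat n * w ^ n)\<bar> \<le> norm ((-1) ^ Suc n / of_nat n * w ^ n)"
      by (rule abs_Re_le_cmod)
    also have "\<dots> = norm w ^ n / n" by (simp add: norm_mult norm_divide norm_power)
    also have "\<dots> \<le> norm w ^ n / 1" using \<open>n \<ge> 1\<close> by (intro divide_left_mono) auto
    finally show "norm \<bar>a n\<bar> \<le> norm w ^ n" using \<open>n \<ge> 1\<close> by (simp add: a_def)
  qed
  have [measurable]: "p \<in> borel_measurable borel"
    unfolding p_def by (intro borel_measurable_continuous_onI continuous_intros)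
  have fi: "integrable lborel (f n)" for n
  proof -
    have "integrable lborel (\<lambda>\<theta>. indicator (cbox 0 1) \<theta> *\<^sub>R (a n * p \<theta> ^ n))"
      unfolding p_def by (intro borel_integrable_compact continuous_intros compact_cbox)
    moreover have "f n = (\<lambda>\<theta>. indicator (cbox 0 1) \<theta> *\<^sub>R (a n * p \<theta> ^ n))"
      by (rule ext) (simp add: f_def)
    ultimately show ?thesis by simp
  qed
  have f_le: "norm (f n \<theta>) \<le> indicator (cbox 0 1) \<theta> * \<bar>a n\<bar>" for n \<theta>
    using p_le[of \<theta>]
    by (auto simp: f_def indicator_def abs_mult power_abs intro!: mult_right_le_one_le power_le_one)
  have "(\<lambda>n. integral\<^sup>L lborel (f n)) sums (\<integral>\<theta>. suminf (\<lambda>n. f n \<theta>) \<partial>lborel)"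
  proof (rule sums_integral[OF fi])
    show "AE \<theta> in lborel. summable (\<lambda>n. norm (f n \<theta>))"
    proof (rule AE_I2, rule summable_comparison_test'[OF a_summable])
      fix n and \<theta> :: "real^3"
      have "indicator (cbox 0 1) \<theta> * \<bar>a n\<bar> \<le> 1 * \<bar>a n\<bar>"
        by (intro mult_right_mono) (auto simp: indicator_def)
      then show "norm (norm (f n \<theta>)) \<le> \<bar>a n\<bar>" using f_le[of n \<theta>] by simp
    qed
    show "summable (\<lambda>n. \<integral>\<theta>. norm (f n \<theta>) \<partial>lborel)"
    proof (rule summable_comparison_test'[OF a_summable])
      fix n
      have "(\<integral>\<theta>. norm (f n \<theta>) \<partial>lborel) \<le> (\<integral>\<theta>. indicator (cbox 0 (1::real^3)) \<theta> * \<bar>a n\<bar> \<partial>lborel)"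
        using fi f_le emeasure_lborel_cbox_finite[of 0 "1::real^3"]
        by (intro integral_mono integrable_mult_left integrable_norm integrable_real_indicator)
          auto
      also have "\<dots> = \<bar>a n\<bar>"
      proof -
        have "0 \<in> cbox 0 (1::real^3)" by (simp add: mem_box_cart)
        then have "cbox 0 (1::real^3) \<noteq> {}" by blast
        then show ?thesis by (simp add: content_cbox_cart)
      qed
      finally show "norm (\<integral>\<theta>. norm (f n \<theta>) \<partial>lborel) \<le> \<bar>a n\<bar>" by simp
    qed
  qed
  also have "(\<lambda>n. integral\<^sup>L lborel (f n)) = (\<lambda>n. a n * (if even n then half_coeff (n div 2) else 0) ^ 3)"
  proof
    fix n
    have "integral\<^sup>L lborel (f n) = a n * (LINT \<theta>:cbox 0 1|lborel. p \<theta> ^ n)"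
      by (simp add: f_def[abs_def] set_lebesgue_integral_def mult.left_commute)
    also have "(LINT \<theta>:cbox 0 1|lborel. p \<theta> ^ n) = (LINT u:{0..1}|lborel. cos (2 * pi * u) ^ n) ^ CARD(3)"
      unfolding p_def prod_power_distrib by (intro set_integral_unit_cube_prod continuous_intros)
    finally show "integral\<^sup>L lborel (f n) = a n * (if even n then half_coeff (n div 2) else 0) ^ 3"
      unfolding cos_power_set_integral by simp
  qed
  also have "(\<integral>\<theta>. suminf (\<lambda>n. f n \<theta>) \<partial>lborel) = mahler_measure (n2_poly r)"
  proof -
    have "suminf (\<lambda>n. f n \<theta>) = indicator (cbox 0 1) \<theta> * ln (norm (r + of_real (8 * p \<theta>)))" for \<theta>
      unfolding f_def by (rule sums_unique[symmetric]) (rule sums_mult[OF a_sums])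
    then show ?thesis
      unfolding mahler_measure_def leval_n2_poly set_lebesgue_integral_def p_def by simp
  qed
  finally have "(\<lambda>n. a n * (if even n then half_coeff (n div 2) else 0) ^ 3) sums mahler_measure (n2_poly r)" .
  \<comment> \<open>Odd moments vanish, so the sum may be reindexed along the even integers.\<close>
  then have "(\<lambda>m. a (2 * m) * (if even (2 * m) then half_coeff (2 * m div 2) else 0) ^ 3) sums mahler_measure (n2_poly r)"
    by (subst sums_mono_reindex) (auto simp: strict_mono_def elim!: evenE)
  then have "(\<lambda>m. a (2 * m) * half_coeff m ^ 3) sums mahler_measure (n2_poly r)"
    by simp
  from sums_mult[OF this, of 2] have "(\<lambda>m. 2 * (a (2 * m) * half_coeff m ^ 3)) sums n2 s"
    by (simp add: n2_def r_def)
  moreover have "2 * (a (2 * m) * half_coeff m ^ 3) =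
      (if m = 0 then ln (norm s) else 0) - Re (fps_nth n2_log_fps m * (64 / s) ^ m)" for m
  proof (cases "m = 0")
    case True
    have "ln (norm s) = 2 * ln (norm r)"
      using r by (simp add: r2[symmetric] norm_power ln_realpow)
    then show ?thesis using True by (simp add: a_def n2_log_fps_def)
  next
    case False
    \<comment> \<open>Only even powers of w survive, so only w^2 = 64/s enters and the choice of the
      square root disappears. The factor 2 in \<open>n2\<close> turns the logarithm coefficient
      -1/(2m) into -1/m.\<close>
    have "w ^ 2 = 64 / s" by (simp add: w_def power_divide r2)
    then have "w ^ (2 * m) = (64 / s) ^ m" by (simp add: power_mult)
    then have "2 * (a (2 * m) * half_coeff m ^ 3) = Re (of_real (half_coeff m ^ 3) * (- ((64 / s) ^ m) / of_nat m))"
      unfolding Re_real using False by (simp add: a_def del: times_complex.sel of_nat_mult) simp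
    also have "\<dots> = - Re (fps_nth n2_log_fps m * (64 / s) ^ m)"
      by (simp add: n2_log_fps_def)
    finally show ?thesis using False by simp
  qed
  moreover have "(\<lambda>m. (if m = 0 then ln (norm s) else 0) - Re (fps_nth n2_log_fps m * (64 / s) ^ m)) sums
      (ln (norm s) - Re (eval_fps n2_log_fps (64 / s)))"
  proof (intro sums_diff sums_Re sums_eval_fps)
    show "(\<lambda>m. if m = 0 then ln (norm s) else 0) sums ln (norm s)"
      using sums_single[of 0 "\<lambda>_. ln (norm s)"] by simp
    have "norm (64 / s) < 1" using s by (simp add: norm_divide divide_less_eq)
    then show "ereal (norm (64 / s)) < fps_conv_radius n2_log_fps"
      using fps_conv_radius_n2_log_fps by (metis ereal_less(3) less_le_trans one_ereal_def ereal_less_eq(3) less_ereal.simps(1))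
  qed
  ultimately show ?thesis by (simp add: sums_iff)
qed

section \<open>Hypergeometric values at the five arguments\<close>

abbreviation hyp2 :: "complex \<Rightarrow> complex" where "hyp2 \<equiv> eval_fps (half_fps 2)"
abbreviation hyp3 :: "complex \<Rightarrow> complex" where "hyp3 \<equiv> eval_fps (half_fps 3)"

lemma hyp_has_fps_expansion: "eval_fps (half_fps k :: complex fps) has_fps_expansion half_fps k"
  using fps_conv_radius_half_fps[of k] by (intro eval_fps_has_fps_expansion) (auto intro: less_le_trans[rotated])

text \<open>The hypergeometric identities are used as identities of germs at 0; this permits
  substituting any parametrization that is continuous at 0 and fixes 0.\<close>

lemma eventually_nhds_0_subst:
  fixes f :: "complex \<Rightarrow> complex"
  assumes "eventually P (nhds 0)" "isCont f 0" "f 0 = 0"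
  shows "eventually (\<lambda>x. P (f x)) (nhds 0)"
proof (rule eventually_compose_filterlim[OF assms(1)])
  show "filterlim f (nhds 0) (nhds 0)"
    using assms(2,3) unfolding isCont_def tendsto_at_iff_tendsto_nhds by simp
qed

lemma eventually_nhds_0_nonzero:
  fixes f :: "complex \<Rightarrow> complex"
  assumes "isCont f 0" "f 0 \<noteq> 0"
  shows "eventually (\<lambda>x. f x \<noteq> 0) (nhds 0)"
  using assms unfolding isCont_def tendsto_at_iff_tendsto_nhds by (rule tendsto_imp_eventually_ne)

lemma has_fps_expansion_eventually_eq:
  assumes "f has_fps_expansion F" "g has_fps_expansion F"
  shows "eventually (\<lambda>x. f x = g x) (nhds 0)"
  using assms unfolding has_fps_expansion_def by (auto elim: eventually_elim2)

lemma clausen_eventually: "eventually (\<lambda>t. hyp3 (4 * t * (1 - t)) = hyp2 t ^ 2) (nhds 0)"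
proof -
  have "(\<lambda>t::complex. 4 * t * (1 - t)) has_fps_expansion 4 * fps_X * (1 - fps_X)"
    by (intro fps_expansion_intros)
  with hyp_has_fps_expansion[of 3] have "(hyp3 \<circ> (\<lambda>t. 4 * t * (1 - t))) has_fps_expansion (half_fps 3 oo (4 * fps_X * (1 - fps_X)))"
    by (rule has_fps_expansion_compose) (simp add: mult.assoc)
  moreover have "(\<lambda>t. hyp2 t ^ 2) has_fps_expansion half_fps 2 ^ 2"
    by (intro fps_expansion_intros hyp_has_fps_expansion)
  ultimately show ?thesis
    unfolding clausen using has_fps_expansion_eventually_eq by force
qed

lemma landen_eventually: "eventually (\<lambda>y. hyp2 (4 * y / (1 + y)^2) = (1 + y) * hyp2 (y^2)) (nhds 0)"
proof -
  have "(\<lambda>y::complex. 4 * y * inverse (1 + y) ^ 2) has_fps_expansion 4 * fps_X * inverse (1 + fps_X) ^ 2"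
    by (intro fps_expansion_intros) auto
  with hyp_has_fps_expansion[of 2]
  have "(hyp2 \<circ> (\<lambda>y. 4 * y * inverse (1 + y) ^ 2)) has_fps_expansion (half_fps 2 oo (4 * fps_X * inverse (1 + fps_X) ^ 2))"
    by (rule has_fps_expansion_compose) (simp add: mult.assoc)
  moreover have "(hyp2 \<circ> (\<lambda>y. y ^ 2)) has_fps_expansion (half_fps 2 oo fps_X ^ 2)"
    by (intro has_fps_expansion_compose fps_expansion_intros hyp_has_fps_expansion) auto
  then have "(\<lambda>y. (1 + y) * hyp2 (y ^ 2)) has_fps_expansion ((1 + fps_X) * (half_fps 2 oo fps_X ^ 2))"
    by (intro fps_expansion_intros) (simp add: o_def)
  ultimately show ?thesis
    unfolding landen using has_fps_expansion_eventually_eq by (force simp: field_simps)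
qed

text \<open>Clausen's formula at T = 4y/(1 + y)^2, then Landen, then Clausen backwards at y^2. Here
  1 - T = ((1 - y)/(1 + y))^2.\<close>

lemma hyp3_quadratic:
  "eventually (\<lambda>y. hyp3 (16 * y * (1 - y)^2 / (1 + y)^4) = (1 + y)^2 * hyp3 (4 * y^2 * (1 - y^2))) (nhds 0)"
proof -
  have "eventually (\<lambda>y::complex. 1 + y \<noteq> 0) (nhds 0)"
    by (rule eventually_nhds_0_nonzero) (auto intro!: continuous_intros)
  moreover have "eventually (\<lambda>y. hyp3 (4 * (4 * y / (1 + y)^2) * (1 - 4 * y / (1 + y)^2)) = hyp2 (4 * y / (1 + y)^2) ^ 2) (nhds 0)"
    by (rule eventually_nhds_0_subst[OF clausen_eventually]) (auto intro!: continuous_intros)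
  moreover have "eventually (\<lambda>y. hyp3 (4 * y^2 * (1 - y^2)) = hyp2 (y^2) ^ 2) (nhds 0)"
    by (rule eventually_nhds_0_subst[OF clausen_eventually]) (auto intro!: continuous_intros)
  ultimately show ?thesis using landen_eventually
  proof eventually_elim
    case (elim y)
    have "4 * (4 * y / (1 + y)^2) * (1 - 4 * y / (1 + y)^2) = 16 * y * (1 - y)^2 / (1 + y)^4"
      using elim(1) by (simp add: divide_simps) algebra
    then show ?case using elim by (simp add: power_mult_distrib)
  qed
qed

text \<open>The preceding identity at \<open>y\<close> and at \<open>-y\<close>, where \<open>t = 4y/(1+y)\<^sup>2\<close>, has the same right-hand
  hypergeometric value.\<close>

lemma hyp3_involution:
  "eventually (\<lambda>t. hyp3 (- 4 * t / (1 - t)^2) = (1 - t) * hyp3 (4 * t * (1 - t))) (nhds 0)"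
proof -
  \<comment> \<open>This is the solution of t = 4y/(1 + y)^2 that vanishes at t = 0.\<close>
  let ?y = "\<lambda>t. (1 - csqrt (1 - t)) / (1 + csqrt (1 - t))"
  have c: "isCont (\<lambda>t. csqrt (1 - t)) 0"
    by (rule isCont_o2[where g=csqrt]) (auto intro!: continuous_at_csqrt)
  have y: "isCont ?y 0" by (intro continuous_intros c) auto
  have "eventually (\<lambda>t. 1 + csqrt (1 - t) \<noteq> 0) (nhds 0)"
    by (rule eventually_nhds_0_nonzero) (auto intro!: continuous_intros c)
  moreover have "eventually (\<lambda>t::complex. 1 - t \<noteq> 0) (nhds 0)"
    by (rule eventually_nhds_0_nonzero) (auto intro!: continuous_intros)
  moreover have "eventually (\<lambda>t. hyp3 (16 * ?y t * (1 - ?y t)^2 / (1 + ?y t)^4) = (1 + ?y t)^2 * hyp3 (4 * (?y t)^2 * (1 - (?y t)^2))) (nhds 0)"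
    by (rule eventually_nhds_0_subst[OF hyp3_quadratic y]) auto
  moreover have "eventually (\<lambda>t. hyp3 (16 * (- ?y t) * (1 - (- ?y t))^2 / (1 + (- ?y t))^4)
       = (1 + (- ?y t))^2 * hyp3 (4 * (- ?y t)^2 * (1 - (- ?y t)^2))) (nhds 0)"
    by (rule eventually_nhds_0_subst[OF hyp3_quadratic, where f="\<lambda>t. - ?y t"]) (auto intro!: continuous_intros c)
  ultimately show ?thesis
  proof eventually_elim
    case (elim t)
    define p y where "p = csqrt (1 - t)" and "y = ?y t"
    have t: "t = 1 - p^2" by (simp add: p_def)
    have nz: "1 + p \<noteq> 0" "p \<noteq> 0" using elim(1,2) by (auto simp: p_def)
    have yp: "y = (1 - p) / (1 + p)" by (simp add: y_def p_def)
    have y1: "1 + y = 2 / (1 + p)" and y2: "1 - y = 2 * p / (1 + p)" using nz by (auto simp: yp field_simps)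
    have "16 * y * (1 - y)^2 / (1 + y)^4 = 4 * t * (1 - t)"
      unfolding y1 y2 unfolding yp t using nz by (simp add: divide_simps) algebra
    moreover have "16 * (- y) * (1 - (- y))^2 / (1 + (- y))^4 = - 4 * t / (1 - t)^2"
      unfolding diff_minus_eq_add add_uminus_conv_diff y1 y2 unfolding yp t using nz by (simp add: divide_simps) algebra
    ultimately have "hyp3 (4 * t * (1 - t)) = (1 + y)^2 * hyp3 (4 * y^2 * (1 - y^2))"
      and "hyp3 (- 4 * t / (1 - t)^2) = (1 - y)^2 * hyp3 (4 * y^2 * (1 - y^2))"
      using elim(3,4) unfolding y_def[symmetric] by simp_all
    \<comment> \<open>Indeed (1 - y)/(1 + y) is the square root p of 1 - t, so the ratio of the two
      prefactors is 1 - t.\<close>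
    moreover have "(1 - y)^2 = (1 - t) * (1 + y)^2"
      unfolding y1 y2 unfolding t using nz by (simp add: divide_simps)
    ultimately show ?case by simp
  qed
qed

text \<open>These are the five values of \<open>64/s\<close> in the theorem, expressed through
  \<open>x = (1-r)/(1+r)\<close> with \<open>r = (1-t)\<^bsup>1/4\<^esup>\<close>.\<close>

definition arg1 :: "complex \<Rightarrow> complex" where "arg1 x = 32 * x * (1 + x^2) * (1 - x)^4 / (1 + x)^8"
definition arg2 :: "complex \<Rightarrow> complex" where "arg2 x = 16 * x^2 * ((1 - x) * (1 + x))^2 / (1 + x^2)^4"
definition arg3 :: "complex \<Rightarrow> complex" where "arg3 x = - 4 * x^4 / ((1 - x) * (1 + x) * (1 + x^2))^2"
definition arg4 :: "complex \<Rightarrow> complex" where "arg4 x = - 32 * x * (1 + x^2) * (1 + x)^4 / (1 - x)^8"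
definition arg5 :: "complex \<Rightarrow> complex" where "arg5 x = 4 * x^4 * ((1 - x) * (1 + x) * (1 + x^2))"

text \<open>The quadratic transformation at y = x^2.\<close>

lemma hyp3_arg2: "eventually (\<lambda>x. hyp3 (arg2 x) = (1 + x^2)^2 * hyp3 (arg5 x)) (nhds 0)"
proof -
  have "eventually (\<lambda>x. hyp3 (16 * x^2 * (1 - x^2)^2 / (1 + x^2)^4) = (1 + x^2)^2 * hyp3 (4 * (x^2)^2 * (1 - (x^2)^2))) (nhds 0)"
    by (rule eventually_nhds_0_subst[OF hyp3_quadratic]) (auto intro!: continuous_intros)
  moreover have "arg2 x = 16 * x^2 * (1 - x^2)^2 / (1 + x^2)^4" for x
    unfolding arg2_def by (simp add: power2_eq_square algebra_simps)
  moreover have "arg5 x = 4 * (x^2)^2 * (1 - (x^2)^2)" for x unfolding arg5_def by algebra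
  ultimately show ?thesis by simp
qed

text \<open>A second quadratic transformation, at y = 2x/(1 + x^2), where 1 + y and 1 - y are
  squares divided by 1 + x^2. It leads from \<open>arg1\<close> to \<open>arg2\<close>, and the
  previous lemma finishes.\<close>

lemma hyp3_arg1: "eventually (\<lambda>x. hyp3 (arg1 x) = (1 + x)^4 * hyp3 (arg5 x)) (nhds 0)"
proof -
  let ?y = "\<lambda>x. 2 * x / (1 + x^2)"
  have "eventually (\<lambda>x::complex. 1 + x \<noteq> 0) (nhds 0)" "eventually (\<lambda>x::complex. 1 + x^2 \<noteq> 0) (nhds 0)"
    by (rule eventually_nhds_0_nonzero; auto intro!: continuous_intros)+
  moreover have "eventually (\<lambda>x. hyp3 (16 * ?y x * (1 - ?y x)^2 / (1 + ?y x)^4) = (1 + ?y x)^2 * hyp3 (4 * (?y x)^2 * (1 - (?y x)^2))) (nhds 0)"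
    by (rule eventually_nhds_0_subst[OF hyp3_quadratic]) (auto intro!: continuous_intros)
  ultimately show ?thesis using hyp3_arg2
  proof eventually_elim
    case (elim x)
    have y1: "1 + ?y x = (1 + x)^2 / (1 + x^2)" and y2: "1 - ?y x = (1 - x)^2 / (1 + x^2)"
      using elim(2) by (auto simp: field_simps power2_eq_square)
    have "16 * ?y x * (1 - ?y x)^2 / (1 + ?y x)^4 = arg1 x"
      unfolding y1 y2 arg1_def using elim(1,2) by (simp add: divide_simps power_mult_distrib) algebra
    moreover have "4 * (?y x)^2 * (1 - (?y x)^2) = arg2 x"
    proof -
      have "4 * (?y x)^2 * (1 - (?y x)^2) = 4 * (?y x)^2 * ((1 - ?y x) * (1 + ?y x))" by algebra
      also have "\<dots> = arg2 x"
        unfolding y1 y2 arg2_def by (simp add: power_mult_distrib power_divide eval_nat_numeral mult_ac)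
      finally show ?thesis .
    qed
    ultimately have "hyp3 (arg1 x) = ((1 + x)^2 / (1 + x^2))^2 * ((1 + x^2)^2 * hyp3 (arg5 x))"
      using elim(3,4) unfolding y1 by simp
    then show ?case using elim(2) by (simp add: power_divide)
  qed
qed

text \<open>The reflection x to -x fixes \<open>arg5\<close> and carries \<open>arg1\<close> to
  \<open>arg4\<close>.\<close>

lemma hyp3_arg4: "eventually (\<lambda>x. hyp3 (arg4 x) = (1 - x)^4 * hyp3 (arg5 x)) (nhds 0)"
proof -
  have "eventually (\<lambda>x. hyp3 (arg1 (- x)) = (1 + (- x))^4 * hyp3 (arg5 (- x))) (nhds 0)"
    by (rule eventually_nhds_0_subst[OF hyp3_arg1]) (auto intro!: continuous_intros)
  moreover have "arg1 (- x) = arg4 x" "arg5 (- x) = arg5 x" for x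
    by (simp_all add: arg1_def arg4_def arg5_def mult.commute)
  ultimately show ?thesis by simp
qed

text \<open>The involution at t = x^4.\<close>

lemma hyp3_arg3: "eventually (\<lambda>x. hyp3 (arg3 x) = (1 - x) * (1 + x) * (1 + x^2) * hyp3 (arg5 x)) (nhds 0)"
proof -
  have "eventually (\<lambda>x. hyp3 (- 4 * x^4 / (1 - x^4)^2) = (1 - x^4) * hyp3 (4 * x^4 * (1 - x^4))) (nhds 0)"
    by (rule eventually_nhds_0_subst[OF hyp3_involution]) (auto intro!: continuous_intros)
  moreover have "1 - x^4 = (1 - x) * (1 + x) * (1 + x^2)" for x :: complex by algebra
  ultimately show ?thesis unfolding arg3_def arg5_def by simp
qed


section \<open>Differentiating the relation\<close>

lemma n2_log_fps_deriv: "fps_X * fps_deriv n2_log_fps = half_fps 3 - 1"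
  by (rule fps_ext) (auto simp: fps_nth_X_deriv n2_log_fps_def half_fps_def)

lemma n2_log_has_derivative:
  assumes z: "norm z < 1" "z \<noteq> 0"
  shows "(eval_fps n2_log_fps has_field_derivative (hyp3 z - 1) / z) (at z)"
proof -
  have r: "ereal (norm z) < fps_conv_radius f" if "fps_conv_radius f \<ge> 1" for f :: "complex fps"
    using that z(1) by (metis ereal_less_eq(3) less_le_trans one_ereal_def less_ereal.simps(1))
  note rs = r[OF fps_conv_radius_n2_log_fps] r[OF fps_conv_radius_half_fps[of 3]]
  have "fps_conv_radius (fps_deriv n2_log_fps) \<ge> 1"
    using fps_conv_radius_deriv[of n2_log_fps] fps_conv_radius_n2_log_fps by (rule order_trans[rotated])
  from r[OF this] have "z * eval_fps (fps_deriv n2_log_fps) z = eval_fps (fps_X * fps_deriv n2_log_fps) z"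
    by (subst eval_fps_mult) auto
  also have "\<dots> = hyp3 z - 1"
    unfolding n2_log_fps_deriv using rs by (subst eval_fps_diff) auto
  finally have "eval_fps (fps_deriv n2_log_fps) z = (hyp3 z - 1) / z" using z by (simp add: field_simps)
  moreover have "(eval_fps n2_log_fps has_field_derivative eval_fps (fps_deriv n2_log_fps) z) (at z)"
    using rs by (intro has_field_derivative_eval_fps) auto
  ultimately show ?thesis by simp
qed

lemma n2_inverse:
  assumes "norm z < 1" "z \<noteq> 0"
  shows "n2 (64 / z) = ln 64 - ln (norm z) - Re (eval_fps n2_log_fps z)"
proof -
  have "norm (64 / z) > 64" using assms by (simp add: norm_divide less_divide_eq)
  from n2_eq_eval_fps[OF this] show ?thesis
    using assms by (simp add: norm_divide ln_div)
qed

text \<open>Stated as f' = f l instead of f'/f = l, so that the product and power rules carry no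
  nonvanishing side conditions.\<close>

definition has_log_deriv :: "(complex \<Rightarrow> complex) \<Rightarrow> complex \<Rightarrow> complex \<Rightarrow> bool" where
  "has_log_deriv f l x \<longleftrightarrow> (f has_field_derivative f x * l) (at x)"

lemma has_log_deriv_const: "has_log_deriv (\<lambda>_. c) 0 x"
  by (simp add: has_log_deriv_def)

lemma has_log_deriv_basic:
  assumes "(f has_field_derivative d) (at x)" "f x \<noteq> 0"
  shows "has_log_deriv f (d / f x) x"
  using assms by (simp add: has_log_deriv_def)

lemma has_log_deriv_mult:
  assumes "has_log_deriv f k x" "has_log_deriv g l x"
  shows "has_log_deriv (\<lambda>x. f x * g x) (k + l) x"
  using DERIV_mult[of f _ x UNIV g] assms by (force simp: has_log_deriv_def algebra_simps)

lemma has_log_deriv_power: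
  assumes "has_log_deriv f k x"
  shows "has_log_deriv (\<lambda>x. f x ^ n) (of_nat n * k) x"
proof (induction n)
  case 0
  then show ?case by (simp add: has_log_deriv_def)
next
  case (Suc n)
  from has_log_deriv_mult[OF assms this] show ?case by (simp add: algebra_simps)
qed

lemma has_log_deriv_divide:
  assumes "has_log_deriv f k x" "has_log_deriv g l x" "g x \<noteq> 0"
  shows "has_log_deriv (\<lambda>x. f x / g x) (k - l) x"
proof -
  have "((\<lambda>x. f x / g x) has_field_derivative (f x * k * g x - f x * (g x * l)) / (g x * g x)) (at x)"
    using assms by (intro DERIV_divide) (auto simp: has_log_deriv_def)
  moreover have "(f x * k * g x - f x * (g x * l)) / (g x * g x) = f x / g x * (k - l)"
    using assms(3) by (simp add: field_simps)
  ultimately show ?thesis by (simp add: has_log_deriv_def)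
qed

text \<open>Since z times the derivative of the series at z is \<open>hyp3 z - 1\<close>, the chain
  rule involves f only through \<open>hyp3 (f x)\<close> and f'/f.\<close>

lemma n2_log_chain:
  assumes "has_log_deriv f l x" "norm (f x) < 1" "f x \<noteq> 0"
  shows "((\<lambda>x. eval_fps n2_log_fps (f x)) has_field_derivative (hyp3 (f x) - 1) * l) (at x)"
  using DERIV_chain2[where f="eval_fps n2_log_fps" and g=f, OF n2_log_has_derivative[OF assms(2,3)]] assms
  by (force simp: has_log_deriv_def)

lemma has_log_deriv_eq: "has_log_deriv f k x \<Longrightarrow> k = l \<Longrightarrow> has_log_deriv f l x"
  by simp

lemma factor_log_derivs:
  shows "1 - x \<noteq> 0 \<Longrightarrow> has_log_deriv (\<lambda>x. 1 - x) (- 1/(1-x)) x"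
    and "1 + x \<noteq> 0 \<Longrightarrow> has_log_deriv (\<lambda>x. 1 + x) (1/(1+x)) x"
    and "1 + x^2 \<noteq> 0 \<Longrightarrow> has_log_deriv (\<lambda>x. 1 + x^2) (2*x/(1+x^2)) x"
  by (intro has_log_deriv_basic; auto intro!: derivative_eq_intros)+

lemma arg_log_derivs:
  assumes x: "x \<noteq> 0" "1 - x \<noteq> 0" "1 + x \<noteq> 0" "1 + x^2 \<noteq> 0"
  shows "has_log_deriv arg1 (1/x + 2*x/(1+x^2) - 4/(1-x) - 8/(1+x)) x"
    and "has_log_deriv arg2 (2/x - 2/(1-x) + 2/(1+x) - 8*x/(1+x^2)) x"
    and "has_log_deriv arg3 (4/x + 2/(1-x) - 2/(1+x) - 4*x/(1+x^2)) x"
    and "has_log_deriv arg4 (1/x + 2*x/(1+x^2) + 4/(1+x) + 8/(1-x)) x"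
    and "has_log_deriv arg5 (4/x - 1/(1-x) + 1/(1+x) + 2*x/(1+x^2)) x"
proof -
  have X: "has_log_deriv (\<lambda>x. x) (1/x) x"
    using x by (intro has_log_deriv_basic) (auto intro!: derivative_eq_intros)
  note M = factor_log_derivs(1)[OF x(2)] and P = factor_log_derivs(2)[OF x(3)] and Q = factor_log_derivs(3)[OF x(4)]
  note rules = has_log_deriv_mult has_log_deriv_divide has_log_deriv_power X M P Q has_log_deriv_const
  show "has_log_deriv arg1 (1/x + 2*x/(1+x^2) - 4/(1-x) - 8/(1+x)) x"
    unfolding arg1_def[abs_def] by (rule has_log_deriv_eq, (rule rules)+) (use x in auto)
  show "has_log_deriv arg2 (2/x - 2/(1-x) + 2/(1+x) - 8*x/(1+x^2)) x"
    unfolding arg2_def[abs_def] by (rule has_log_deriv_eq, (rule rules)+) ((use x in \<open>simp; fail\<close>) | (simp add: ring_distribs; fail))+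
  show "has_log_deriv arg3 (4/x + 2/(1-x) - 2/(1+x) - 4*x/(1+x^2)) x"
    unfolding arg3_def[abs_def] by (rule has_log_deriv_eq, (rule rules)+) ((use x in \<open>simp; fail\<close>) | (simp add: ring_distribs; fail))+
  show "has_log_deriv arg4 (1/x + 2*x/(1+x^2) + 4/(1+x) + 8/(1-x)) x"
    unfolding arg4_def[abs_def] by (rule has_log_deriv_eq, (rule rules)+) (use x in auto)
  show "has_log_deriv arg5 (4/x - 1/(1-x) + 1/(1+x) + 2*x/(1+x^2)) x"
    unfolding arg5_def[abs_def] by (rule has_log_deriv_eq, (rule rules)+) ((use x in \<open>simp; fail\<close>) | (simp add: ring_distribs; fail))+
qed


lemma arg_nonzero:
  assumes "x \<noteq> 0" "1 - x \<noteq> 0" "1 + x \<noteq> 0" "1 + x^2 \<noteq> 0"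
  shows "arg1 x \<noteq> 0" "arg2 x \<noteq> 0" "arg3 x \<noteq> 0" "arg4 x \<noteq> 0" "arg5 x \<noteq> 0"
  using assms by (simp_all add: arg1_def arg2_def arg3_def arg4_def arg5_def)

text \<open>The series part of the claimed relation with all terms on one side, before taking real
  parts and with the overall sign reversed.\<close>

definition log_combination :: "complex \<Rightarrow> complex" where
  "log_combination x = eval_fps n2_log_fps (arg1 x) - 9 * eval_fps n2_log_fps (arg2 x)
    - 4 * eval_fps n2_log_fps (arg3 x) + eval_fps n2_log_fps (arg4 x) + 8 * eval_fps n2_log_fps (arg5 x)"

text \<open>All five hypergeometric values are polynomial multiples of H =
  \<open>hyp3 (arg5 x)\<close>, so the derivative is affine in H. The coefficient of H cancels, and
  what remains comes from the terms -1 alone.\<close>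

lemma log_combination_has_derivative:
  assumes x: "x \<noteq> 0" "1 - x \<noteq> 0" "1 + x \<noteq> 0" "1 + x^2 \<noteq> 0"
    and n: "norm (arg1 x) < 1" "norm (arg2 x) < 1" "norm (arg3 x) < 1" "norm (arg4 x) < 1" "norm (arg5 x) < 1"
    and h: "hyp3 (arg1 x) = (1 + x)^4 * hyp3 (arg5 x)" "hyp3 (arg2 x) = (1 + x^2)^2 * hyp3 (arg5 x)"
      "hyp3 (arg3 x) = (1 - x) * (1 + x) * (1 + x^2) * hyp3 (arg5 x)" "hyp3 (arg4 x) = (1 - x)^4 * hyp3 (arg5 x)"
  shows "(log_combination has_field_derivative (6/(1+x) - 6/(1-x) - 108*x/(1+x^2))) (at x)"
proof -
  define i a b d where "i = 1/x" and "a = 1/(1-x)" and "b = 1/(1+x)" and "d = 1/(1+x^2)"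
  define H where "H = hyp3 (arg5 x)"
  have i: "i * x = 1" "a * (1 - x) = 1" "b * (1 + x) = 1" "d * (1 + x^2) = 1"
    using x by (auto simp: i_def a_def b_def d_def)
  note D = arg_log_derivs[OF x] and N = arg_nonzero[OF x]
  have "(log_combination has_field_derivative
      (hyp3 (arg1 x) - 1) * (1/x + 2*x/(1+x^2) - 4/(1-x) - 8/(1+x))
      - 9 * ((hyp3 (arg2 x) - 1) * (2/x - 2/(1-x) + 2/(1+x) - 8*x/(1+x^2)))
      - 4 * ((hyp3 (arg3 x) - 1) * (4/x + 2/(1-x) - 2/(1+x) - 4*x/(1+x^2)))
      + (hyp3 (arg4 x) - 1) * (1/x + 2*x/(1+x^2) + 4/(1+x) + 8/(1-x))
      + 8 * ((hyp3 (arg5 x) - 1) * (4/x - 1/(1-x) + 1/(1+x) + 2*x/(1+x^2)))) (at x)"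
    unfolding log_combination_def[abs_def]
    by (intro DERIV_add DERIV_diff DERIV_cmult n2_log_chain D n N)
  also have "(hyp3 (arg1 x) - 1) * (1/x + 2*x/(1+x^2) - 4/(1-x) - 8/(1+x))
      - 9 * ((hyp3 (arg2 x) - 1) * (2/x - 2/(1-x) + 2/(1+x) - 8*x/(1+x^2)))
      - 4 * ((hyp3 (arg3 x) - 1) * (4/x + 2/(1-x) - 2/(1+x) - 4*x/(1+x^2)))
      + (hyp3 (arg4 x) - 1) * (1/x + 2*x/(1+x^2) + 4/(1+x) + 8/(1-x))
      + 8 * ((hyp3 (arg5 x) - 1) * (4/x - 1/(1-x) + 1/(1+x) + 2*x/(1+x^2)))
    = ((1 + x)^4 * H - 1) * (i + 2*x*d - 4*a - 8*b)
      - 9 * (((1 + x^2)^2 * H - 1) * (2*i - 2*a + 2*b - 8*x*d))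
      - 4 * (((1 - x) * (1 + x) * (1 + x^2) * H - 1) * (4*i + 2*a - 2*b - 4*x*d))
      + ((1 - x)^4 * H - 1) * (i + 2*x*d + 4*b + 8*a)
      + 8 * ((H - 1) * (4*i - a + b + 2*x*d))"
    unfolding h by (simp add: i_def a_def b_def d_def H_def)
  also have "\<dots> = 6*b - 6*a - 108*x*d"
  proof -
    \<comment> \<open>The vanishing of the coefficient of H, derived from the defining relations of
      the four reciprocals.\<close>
    have "(1 + x)^4 * (i + 2*x*d - 4*a - 8*b) - 9 * ((1 + x^2)^2 * (2*i - 2*a + 2*b - 8*x*d))
      - 4 * ((1 - x) * (1 + x) * (1 + x^2) * (4*i + 2*a - 2*b - 4*x*d))
      + (1 - x)^4 * (i + 2*x*d + 4*b + 8*a) + 8 * (4*i - a + b + 2*x*d) = 0"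
      using i by algebra
    then show ?thesis by algebra
  qed
  also have "\<dots> = 6/(1+x) - 6/(1-x) - 108*x/(1+x^2)"
    by (simp add: a_def b_def d_def)
  finally show ?thesis .
qed


lemma arg_cont: "isCont arg1 0" "isCont arg2 0" "isCont arg3 0" "isCont arg4 0" "isCont arg5 0"
  unfolding arg1_def[abs_def] arg2_def[abs_def] arg3_def[abs_def] arg4_def[abs_def] arg5_def[abs_def]
  by (intro continuous_intros; simp)+

lemma arg_0: "arg1 0 = 0" "arg2 0 = 0" "arg3 0 = 0" "arg4 0 = 0" "arg5 0 = 0"
  by (simp_all add: arg1_def arg2_def arg3_def arg4_def arg5_def)

lemma eventually_norm_less_1:
  fixes f :: "complex \<Rightarrow> complex"
  assumes "isCont f 0" "f 0 = 0"
  shows "eventually (\<lambda>x. norm (f x) < 1) (nhds 0)"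
proof (rule eventually_nhds_0_subst[OF _ assms])
  show "eventually (\<lambda>x::complex. norm x < 1) (nhds 0)"
    unfolding eventually_nhds_metric by (intro exI[of _ 1]) auto
qed

text \<open>The derivative just found integrates to logarithms; exponentiating avoids a choice of
  branches. The exponents 54 and -6 are those for which the rational factor has the opposite
  logarithmic derivative, so the product is constant, with value 1 at 0.\<close>

lemma log_combination_identity:
  obtains \<delta> where "\<delta> > 0"
    and "\<And>x::complex. norm x < \<delta> \<Longrightarrow> 1 - x \<noteq> 0 \<and> 1 + x \<noteq> 0 \<and> 1 + x^2 \<noteq> 0"
    and "\<And>x::complex. norm x < \<delta> \<Longrightarrow> norm (arg1 x) < 1 \<and> norm (arg2 x) < 1 \<and> norm (arg3 x) < 1 \<and> norm (arg4 x) < 1 \<and> norm (arg5 x) < 1"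
    and "\<And>x::complex. norm x < \<delta> \<Longrightarrow> (1 + x^2)^54 / ((1 - x) * (1 + x))^6 * exp (log_combination x) = 1"
proof -
  have nonzero: "eventually (\<lambda>x::complex. 1 - x \<noteq> 0) (nhds 0)" "eventually (\<lambda>x::complex. 1 + x \<noteq> 0) (nhds 0)"
    "eventually (\<lambda>x::complex. 1 + x^2 \<noteq> 0) (nhds 0)"
    by (rule eventually_nhds_0_nonzero; auto intro!: continuous_intros)+
  have "eventually (\<lambda>x. (1 - x \<noteq> 0 \<and> 1 + x \<noteq> 0 \<and> 1 + x^2 \<noteq> 0) \<and>
      (norm (arg1 x) < 1 \<and> norm (arg2 x) < 1 \<and> norm (arg3 x) < 1 \<and> norm (arg4 x) < 1 \<and> norm (arg5 x) < 1) \<and>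
      hyp3 (arg1 x) = (1 + x)^4 * hyp3 (arg5 x) \<and> hyp3 (arg2 x) = (1 + x^2)^2 * hyp3 (arg5 x) \<and>
      hyp3 (arg3 x) = (1 - x) * (1 + x) * (1 + x^2) * hyp3 (arg5 x) \<and> hyp3 (arg4 x) = (1 - x)^4 * hyp3 (arg5 x)) (nhds 0)"
    by (intro eventually_conj nonzero eventually_norm_less_1[OF arg_cont(1) arg_0(1)] eventually_norm_less_1[OF arg_cont(2) arg_0(2)]
        eventually_norm_less_1[OF arg_cont(3) arg_0(3)] eventually_norm_less_1[OF arg_cont(4) arg_0(4)]
        eventually_norm_less_1[OF arg_cont(5) arg_0(5)] hyp3_arg1 hyp3_arg2 hyp3_arg3 hyp3_arg4)
  then obtain \<delta> where \<delta>: "\<delta> > 0" and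
    nz: "\<And>x::complex. norm x < \<delta> \<Longrightarrow> 1 - x \<noteq> 0 \<and> 1 + x \<noteq> 0 \<and> 1 + x^2 \<noteq> 0" and
    lt: "\<And>x::complex. norm x < \<delta> \<Longrightarrow> norm (arg1 x) < 1 \<and> norm (arg2 x) < 1 \<and> norm (arg3 x) < 1 \<and> norm (arg4 x) < 1 \<and> norm (arg5 x) < 1" and
    h: "\<And>x::complex. norm x < \<delta> \<Longrightarrow> hyp3 (arg1 x) = (1 + x)^4 * hyp3 (arg5 x) \<and> hyp3 (arg2 x) = (1 + x^2)^2 * hyp3 (arg5 x) \<and>
      hyp3 (arg3 x) = (1 - x) * (1 + x) * (1 + x^2) * hyp3 (arg5 x) \<and> hyp3 (arg4 x) = (1 - x)^4 * hyp3 (arg5 x)"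
    unfolding eventually_nhds_metric dist_norm diff_zero by auto
  define E where "E x = (1 + x^2)^54 / ((1 - x) * (1 + x))^6 * exp (log_combination x)" for x :: complex
  have radius: "ereal (norm z) < fps_conv_radius n2_log_fps" if "norm z < 1" for z :: complex
    using that fps_conv_radius_n2_log_fps by (metis ereal_less_eq(3) less_le_trans one_ereal_def less_ereal.simps(1))
  have "E constant_on ball 0 \<delta>"
  \<comment> \<open>The derivative formula contains 1/x, so it is used only off the origin;
    continuity on the ball covers x = 0.\<close>
  proof (rule DERIV_zero_connected_constant_on)
    have "continuous_on (ball 0 \<delta>) arg1" "continuous_on (ball 0 \<delta>) arg2" "continuous_on (ball 0 \<delta>) arg3"
      "continuous_on (ball 0 \<delta>) arg4" "continuous_on (ball 0 \<delta>) arg5"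
      unfolding arg1_def[abs_def] arg2_def[abs_def] arg3_def[abs_def] arg4_def[abs_def] arg5_def[abs_def]
      by (intro continuous_intros; use nz in simp)+
    then have "continuous_on (ball 0 \<delta>) log_combination"
      unfolding log_combination_def[abs_def] using lt
      by (intro continuous_on_add continuous_on_diff continuous_on_mult continuous_on_const continuous_on_eval_fps')
        (auto simp: in_eball_iff radius)
    then show "continuous_on (ball 0 \<delta>) E"
      unfolding E_def[abs_def] by (intro continuous_intros) (use nz in auto)
    show "\<forall>x\<in>ball 0 \<delta> - {0}. DERIV E x :> 0"
    proof
      fix x :: complex assume "x \<in> ball 0 \<delta> - {0}"
      then have x: "norm x < \<delta>" "x \<noteq> 0" by auto
      note D = log_combination_has_derivative[of x]
      have L: "(log_combination has_field_derivative (6/(1+x) - 6/(1-x) - 108*x/(1+x^2))) (at x)"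
        using nz[OF x(1)] lt[OF x(1)] h[OF x(1)] x(2) by (intro D) auto
      note M = factor_log_derivs(1)[of x] and P = factor_log_derivs(2)[of x] and Q = factor_log_derivs(3)[of x]
      have X: "has_log_deriv (\<lambda>x. exp (log_combination x)) (6/(1+x) - 6/(1-x) - 108*x/(1+x^2)) x"
        using DERIV_chain2[OF DERIV_exp L] by (simp add: has_log_deriv_def)
      have "has_log_deriv E (of_nat 54 * (2*x/(1+x^2)) - of_nat 6 * (- 1/(1-x) + 1/(1+x))
          + (6/(1+x) - 6/(1-x) - 108*x/(1+x^2))) x"
        unfolding E_def[abs_def]
        by (intro has_log_deriv_mult has_log_deriv_divide has_log_deriv_power M P Q X) (use nz[OF x(1)] in auto)
      then show "DERIV E x :> 0" by (simp add: has_log_deriv_def ring_distribs)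
    qed
  qed auto
  moreover have "E 0 = 1"
    by (simp add: E_def log_combination_def arg_0 eval_fps_at_0 n2_log_fps_def)
  ultimately have "E x = 1" if "norm x < \<delta>" for x
    using that \<delta> unfolding constant_on_def by (metis centre_in_ball mem_ball_0)
  then show ?thesis using \<delta> nz lt by (intro that) (auto simp: E_def)
qed

text \<open>Taking ln of the modulus in the previous identity gives the real part of the series
  combination. In the logarithms of the |arg_i| the multiples of ln |x| cancel, those of ln 2 cancel
  against the ln 64 terms, and the rest is 54 ln |1 + x^2| - 6 ln |1 - x^2|, which that real part
  compensates.\<close>

lemma n2_relation:
  obtains \<delta> where "\<delta> > 0"
    and "\<And>x::complex. norm x < \<delta> \<Longrightarrow> x \<noteq> 0 \<Longrightarrow> 1 - x \<noteq> 0 \<and> 1 + x \<noteq> 0 \<and> 1 + x^2 \<noteq> 0 \<and>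
      n2 (64 / arg1 x) = 9 * n2 (64 / arg2 x) + 4 * n2 (64 / arg3 x) - n2 (64 / arg4 x) - 8 * n2 (64 / arg5 x)"
proof (rule log_combination_identity)
  fix \<delta> :: real
  assume \<delta>: "\<delta> > 0"
    and nz: "\<And>x::complex. norm x < \<delta> \<Longrightarrow> 1 - x \<noteq> 0 \<and> 1 + x \<noteq> 0 \<and> 1 + x^2 \<noteq> 0"
    and lt: "\<And>x::complex. norm x < \<delta> \<Longrightarrow> norm (arg1 x) < 1 \<and> norm (arg2 x) < 1 \<and> norm (arg3 x) < 1 \<and> norm (arg4 x) < 1 \<and> norm (arg5 x) < 1"
    and id: "\<And>x::complex. norm x < \<delta> \<Longrightarrow> (1 + x^2)^54 / ((1 - x) * (1 + x))^6 * exp (log_combination x) = 1"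
  show thesis
  proof (rule that[OF \<delta>])
    fix x :: complex assume x: "norm x < \<delta>" "x \<noteq> 0"
    note nz = nz[OF x(1)] and lt = lt[OF x(1)]
    define X A B D where "X = ln (norm x)" and "A = ln (norm (1 - x))" and "B = ln (norm (1 + x))" and "D = ln (norm (1 + x^2))"
    have ln2: "ln (64::real) = 6 * ln 2" "ln (32::real) = 5 * ln 2" "ln (16::real) = 4 * ln 2" "ln (4::real) = 2 * ln 2"
      using ln_realpow[of 2 6] ln_realpow[of 2 5] ln_realpow[of 2 4] ln_realpow[of 2 2] by simp_all
    note simps = norm_mult norm_divide norm_power ln_mult ln_div ln_realpow ln2
    have "ln (norm (arg1 x)) = 5 * ln 2 + X + D + 4 * A - 8 * B"
      "ln (norm (arg2 x)) = 4 * ln 2 + 2 * X + 2 * (A + B) - 4 * D"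
      "ln (norm (arg3 x)) = 2 * ln 2 + 4 * X - 2 * (A + B + D)"
      "ln (norm (arg4 x)) = 5 * ln 2 + X + D + 4 * B - 8 * A"
      "ln (norm (arg5 x)) = 2 * ln 2 + 4 * X + (A + B + D)"
      unfolding arg1_def arg2_def arg3_def arg4_def arg5_def X_def A_def B_def D_def
      using x(2) nz by (simp_all add: simps)
    moreover have "54 * D - 6 * (A + B) + Re (log_combination x) = 0"
    proof -
      have "ln (norm ((1 + x^2)^54 / ((1 - x) * (1 + x))^6 * exp (log_combination x))) = 0"
        unfolding id[OF x(1)] by simp
      then show ?thesis using nz by (simp add: simps A_def B_def D_def)
    qed
    moreover note n2_inverse[of "arg1 x"] n2_inverse[of "arg2 x"] n2_inverse[of "arg3 x"]
      n2_inverse[of "arg4 x"] n2_inverse[of "arg5 x"]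
    ultimately have "n2 (64 / arg1 x) = 9 * n2 (64 / arg2 x) + 4 * n2 (64 / arg3 x) - n2 (64 / arg4 x) - 8 * n2 (64 / arg5 x)"
      using lt x(2) nz arg_nonzero[of x] ln2 by (simp add: log_combination_def)
    then show "1 - x \<noteq> 0 \<and> 1 + x \<noteq> 0 \<and> 1 + x^2 \<noteq> 0 \<and>
      n2 (64 / arg1 x) = 9 * n2 (64 / arg2 x) + 4 * n2 (64 / arg3 x) - n2 (64 / arg4 x) - 8 * n2 (64 / arg5 x)"
      using nz by blast
  qed
qed

text \<open>To be read with \<open>u = 1 + x\<close>, \<open>d = 1 + x\<^sup>2\<close>, \<open>m = 1 - x\<close>.\<close>

lemma n2_arguments_monomial:
  fixes u d m x :: complex
  assumes nz: "u \<noteq> 0" "d \<noteq> 0" "m \<noteq> 0" "x \<noteq> 0"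
  shows "16 / (8 * x * d / u^4 * (m^4 / u^4)) = 64 / (32 * x * d * m^4 / u^8)" (is ?A)
    and "4 * (2 * d / u^2)^6 / ((8 * x * d / u^4)^2 * (m^2 / u^2)) = 64 / (16 * x^2 * (m * u)^2 / d^4)" (is ?B)
    and "- (2^10) * (2 * d / u^2)^6 * (m^2 / u^2) / (8 * x * d / u^4)^4 = 64 / (- 4 * x^4 / (m * u * d)^2)" (is ?C)
    and "- 16 * (m^4 / u^4)^2 / (8 * x * d / u^4) = 64 / (- 32 * x * d * u^4 / m^8)" (is ?D)
    and "2 * (2 / u)^12 / (8 * x * d / u^4 * (4 * x / u^2)^3 * (m / u)) = 64 / (4 * x^4 * (m * u * d))" (is ?E)
proof -
  show ?A using nz by (simp add: divide_simps power_mult_distrib power_divide flip: power_mult power_add)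
  show ?B using nz by (simp add: divide_simps power_mult_distrib power_divide; algebra?)
  show ?C using nz by (simp add: divide_simps power_mult_distrib power_divide; algebra?)
  show ?D using nz by (simp add: divide_simps power_mult_distrib power_divide; algebra?)
  show ?E using nz by (simp add: divide_simps power_mult_distrib power_divide; algebra?)
qed

section \<open>Return from the parameter x to t\<close>

theorem theorem5p1:
  shows "\<exists>\<epsilon>::real. \<epsilon> > 0 \<and> (\<forall>t::complex. 0 < cmod t \<and> cmod t < \<epsilon> \<longrightarrow>
    (let q = csqrt (1 - t); r = (1 - t) powr (1 / 4) in
      n2 (16 / (t * (1 - t)))
        = 9 * n2 (4 * (1 + q) ^ 6 / (t ^ 2 * q))
        + 4 * n2 (- (2 ^ 10) * (1 + q) ^ 6 * q / t ^ 4)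
        - n2 (- 16 * (1 - t) ^ 2 / t)
        - 8 * n2 (2 * (1 + r) ^ 12 / (t * (1 - q) ^ 3 * r))))"
proof -
  define R where "R t = (1 - t) powr (1 / 4)" for t :: complex
  \<comment> \<open>This map is continuous at 0 and vanishes there, so the radius in x yields a
    radius in t.\<close>
  define \<xi> where "\<xi> t = (1 - R t) / (1 + R t)" for t
  obtain \<delta> where \<delta>: "\<delta> > 0" and rel: "\<And>x::complex. norm x < \<delta> \<Longrightarrow> x \<noteq> 0 \<Longrightarrow> 1 - x \<noteq> 0 \<and> 1 + x \<noteq> 0 \<and> 1 + x^2 \<noteq> 0 \<and>
      n2 (64 / arg1 x) = 9 * n2 (64 / arg2 x) + 4 * n2 (64 / arg3 x) - n2 (64 / arg4 x) - 8 * n2 (64 / arg5 x)"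
    by (rule n2_relation) blast
  have R: "isCont R 0"
    unfolding R_def[abs_def] by (intro continuous_intros isCont_powr_complex) auto
  have R0: "R 0 = 1" by (simp add: R_def)
  have \<xi>: "isCont \<xi> 0" unfolding \<xi>_def[abs_def] by (intro continuous_intros R) (simp add: R0)
  have "eventually (\<lambda>x::complex. norm x < \<delta>) (nhds 0)"
    unfolding eventually_nhds_metric using \<delta> by auto
  then have "eventually (\<lambda>t. norm (\<xi> t) < \<delta>) (nhds 0)"
    by (rule eventually_nhds_0_subst[OF _ \<xi>]) (simp add: \<xi>_def R0)
  moreover have "eventually (\<lambda>t. 1 + R t \<noteq> 0) (nhds 0)"
    by (rule eventually_nhds_0_nonzero) (auto intro!: continuous_intros R simp: R0)
  ultimately have "eventually (\<lambda>t. norm (\<xi> t) < \<delta> \<and> 1 + R t \<noteq> 0) (nhds 0)" by (rule eventually_conj)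
  then obtain \<epsilon> where \<epsilon>: "\<epsilon> > 0" and e: "\<And>t. norm t < \<epsilon> \<Longrightarrow> norm (\<xi> t) < \<delta> \<and> 1 + R t \<noteq> 0"
    unfolding eventually_nhds_metric by (auto simp: dist_norm)
  show ?thesis
  proof (intro exI[of _ \<epsilon>] conjI \<epsilon> allI impI, elim conjE)
    fix t :: complex assume t: "0 < cmod t" "cmod t < \<epsilon>"
    define r q x where "r = R t" and "q = csqrt (1 - t)" and "x = \<xi> t"
    \<comment> \<open>Both roots are principal powers of the same number, so exponents add: 1/4 +
      1/4 = 1/2.\<close>
    have qr: "q = r^2"
      by (simp add: q_def r_def R_def csqrt_conv_powr power2_eq_square flip: powr_add)
    have tq: "1 - t = q^2" by (simp add: q_def)
    have r1: "1 + r \<noteq> 0" and x\<delta>: "norm x < \<delta>" using e[OF t(2)] by (auto simp: r_def x_def)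
    have x_eq: "x = (1 - r) / (1 + r)" by (simp add: x_def \<xi>_def r_def)
    \<comment> \<open>If r = 1 then q = 1 and t = 0, which is excluded.\<close>
    have "r \<noteq> 1" using tq t(1) by (auto simp: qr)
    then have x0: "x \<noteq> 0" by (simp add: x_eq r1)
    note rel = rel[OF x\<delta> x0]
    then have nz: "1 - x \<noteq> 0" "1 + x \<noteq> 0" "1 + x^2 \<noteq> 0" by auto
    \<comment> \<open>The map r to (1 - r)/(1 + r) is an involution, so r, q and t become rational
      in x.\<close>
    have r: "r = (1 - x) / (1 + x)" 
    proof -
      have "1 + x = 2 / (1 + r)" and "1 - x = 2 * r / (1 + r)" using r1 by (auto simp: x_eq field_simps)
      then show ?thesis using r1 by simp
    qed
    have r': "1 + r = 2 / (1 + x)" using nz by (simp add: r field_simps)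
    have q: "q = (1 - x)^2 / (1 + x)^2" by (simp add: qr r power_divide)
    have q': "1 + q = 2 * (1 + x^2) / (1 + x)^2" and q'': "1 - q = 4 * x / (1 + x)^2"
      using nz(2) by (simp_all add: q divide_simps) algebra+
    have t': "1 - t = (1 - x)^4 / (1 + x)^4" by (simp add: tq q power_divide flip: power_mult)
    \<comment> \<open>Factoring 1 - q^2 makes t, like the other quantities, a monomial in x, 1 - x,
      1 + x and 1 + x^2 up to a constant; matching the five arguments is then a comparison of
      exponents.\<close>
    have "t = (1 - q) * (1 + q)" using tq by algebra
    then have t: "t = 8 * x * (1 + x^2) / (1 + x)^4"
      unfolding q' q'' using nz(2) by (simp add: divide_simps)
    have nz': "1 + x \<noteq> 0" "1 + x^2 \<noteq> 0" "1 - x \<noteq> 0" "x \<noteq> 0" using nz x0 by auto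
    note monomial = n2_arguments_monomial[OF nz']
    have "16 / (t * (1 - t)) = 64 / arg1 x"
      unfolding t' unfolding t arg1_def by (rule monomial(1))
    moreover have "4 * (1 + q) ^ 6 / (t ^ 2 * q) = 64 / arg2 x"
      unfolding q' unfolding q t arg2_def by (rule monomial(2))
    moreover have "- (2 ^ 10) * (1 + q) ^ 6 * q / t ^ 4 = 64 / arg3 x"
      unfolding q' unfolding q t arg3_def by (rule monomial(3))
    moreover have "- 16 * (1 - t) ^ 2 / t = 64 / arg4 x"
      unfolding t' unfolding t arg4_def by (rule monomial(4))
    moreover have "2 * (1 + r) ^ 12 / (t * (1 - q) ^ 3 * r) = 64 / arg5 x"
      unfolding r' q'' unfolding t r arg5_def by (rule monomial(5))
    ultimately show "let q = csqrt (1 - t); r = (1 - t) powr (1 / 4) in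
      n2 (16 / (t * (1 - t)))
        = 9 * n2 (4 * (1 + q) ^ 6 / (t ^ 2 * q))
        + 4 * n2 (- (2 ^ 10) * (1 + q) ^ 6 * q / t ^ 4)
        - n2 (- 16 * (1 - t) ^ 2 / t)
        - 8 * n2 (2 * (1 + r) ^ 12 / (t * (1 - q) ^ 3 * r))"
      using rel unfolding Let_def q_def r_def R_def by simp
  qed
qed

end
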